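(* There exists an absolute constant $C \in (0,\infty)$ such that the following holds. Let $p$ be a prime, $n$ a positive integer, $K \geq 1$, and let $A \subseteq \mathbb{F}_p^n$ be a set with $|A| \geq p^{n-1}/K^{24}$ and $|A - A| \leq K|A|$. Then there exists a linear subspace $V \subseteq 2A - 2A$ of $\mathbb{F}_p^n$ with $|V| \geq p^{-C \log^4(Kp)} |A|$.
   Context: $A - A = \{a - b : a,b \in A\}$ and $2A - 2A = \{a_1 + a_2 - a_3 - a_4 : a_1,a_2,a_3,a_4 \in A\}$. *)

theory Defs
  imports Complex_Main "HOL-Algebra.Module" "HOL-Number_Theory.Residues"
begin

text \<open>
  The coordinate space \<open>R^n\<close> as a module over a commutative ring \<open>R\<close>. Vectors are functions on
  \<open>{..<n}\<close> that are \<open>undefined\<close> elsewhere, so equality of vectors is equality of coordinates.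
  The record type also asks for a multiplication and a unit; these are taken coordinatewise and
  play no role in the module structure.
\<close>

definition coord_space :: "('a, 'm) ring_scheme \<Rightarrow> nat \<Rightarrow> ('a, nat \<Rightarrow> 'a) module" where
  "coord_space R n =
    \<lparr>carrier = {..<n} \<rightarrow>\<^sub>E carrier R,
     monoid.mult = (\<lambda>x y. \<lambda>i\<in>{..<n}. x i \<otimes>\<^bsub>R\<^esub> y i),
     one = (\<lambda>i\<in>{..<n}. \<one>\<^bsub>R\<^esub>),
     zero = (\<lambda>i\<in>{..<n}. \<zero>\<^bsub>R\<^esub>),
     add = (\<lambda>x y. \<lambda>i\<in>{..<n}. x i \<oplus>\<^bsub>R\<^esub> y i),
     smult = (\<lambda>c x. \<lambda>i\<in>{..<n}. c \<otimes>\<^bsub>R\<^esub> x i)\<rparr>"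

abbreviation Fp_space :: "nat \<Rightarrow> nat \<Rightarrow> (int, nat \<Rightarrow> int) module" where
  "Fp_space p n \<equiv> coord_space (residue_ring (int p)) n"

definition diff_set :: "('a, 'm) ring_scheme \<Rightarrow> 'a set \<Rightarrow> 'a set" where
  "diff_set G A = {a \<ominus>\<^bsub>G\<^esub> b | a b. a \<in> A \<and> b \<in> A}"

definition double_diff_set :: "('a, 'm) ring_scheme \<Rightarrow> 'a set \<Rightarrow> 'a set" where
  "double_diff_set G A =
    {((a1 \<oplus>\<^bsub>G\<^esub> a2) \<ominus>\<^bsub>G\<^esub> a3) \<ominus>\<^bsub>G\<^esub> a4 | a1 a2 a3 a4.
      a1 \<in> A \<and> a2 \<in> A \<and> a3 \<in> A \<and> a4 \<in> A}"

lemma module_coord_space: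
  assumes "cring R"
  shows "module R (coord_space R n)"
proof -
  interpret cring R by fact
  have neg: "\<exists>y\<in>{..<n} \<rightarrow>\<^sub>E carrier R. (\<lambda>i\<in>{..<n}. y i \<oplus>\<^bsub>R\<^esub> x i) = (\<lambda>i\<in>{..<n}. \<zero>\<^bsub>R\<^esub>)"
    if "x \<in> {..<n} \<rightarrow>\<^sub>E carrier R" for x
    using that
    by (intro bexI[of _ "\<lambda>i\<in>{..<n}. \<ominus>\<^bsub>R\<^esub> x i"]) (auto simp: fun_eq_iff l_neg PiE_iff)
  show ?thesis
  proof (rule moduleI)
    show "abelian_group (coord_space R n)"
      by (rule abelian_groupI)
        (use neg in \<open>auto simp: coord_space_def fun_eq_iff PiE_iff a_ac extensional_def\<close>)
  qed (use assms in \<open>auto simp: coord_space_def fun_eq_iff PiE_iff l_distr r_distr m_assoc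
         extensional_def\<close>)
qed

lemma module_Fp_space:
  assumes "prime p"
  shows "module (residue_ring (int p)) (Fp_space p n)"
proof -
  have "residues (int p)"
    using prime_gt_1_nat[OF assms] by unfold_locales simp
  then show ?thesis
    by (intro module_coord_space residues.cring)
qed

lemma card_carrier_Fp_space: "card (carrier (Fp_space p n)) = p ^ n"
  by (simp add: coord_space_def residue_ring_def card_PiE)

end

theory Submission
  imports Defs "HOL-Analysis.Convex"
begin

text \<open>
  Since \<open>A\<close> has density at least \<open>exp (- 24 * L)\<close> in \<open>F_p^n\<close>, where \<open>L = ln (K * p)\<close>, Sanders'
  argument applies directly, without a Freiman model. Let \<open>S = A + A\<close> and let \<open>H\<close> be the indicator
  function of \<open>S\<close> averaged over two shifts by \<open>A\<close>, so that \<open>H 0 = 1\<close>. Croot--Sisask sampling gives a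
  set \<open>X\<close> of almost periods of \<open>H\<close> of density \<open>exp (- O(L ^ 4))\<close>, and \<open>H\<close> averaged over \<open>l = O(L)\<close>
  shifts from \<open>X\<close> is still at least \<open>3/4\<close> at \<open>0\<close>. By Chang's bound the large spectrum of \<open>X\<close> is
  trivial on a subspace \<open>V\<close> of codimension \<open>O(L ^ 4)\<close>; the other frequencies contribute at most
  \<open>2 ^ (- l)\<close> times a Parseval sum, so averaging over \<open>V\<close> changes little. Hence \<open>S\<close> fills more than
  half of some coset of \<open>V\<close>, and \<open>V \<subseteq> S - S = 2A - 2A\<close>.
\<close>

subsection \<open>Moment inequalities\<close>

text \<open>Termwise comparison of power series, resting on
  \<open>2 ^ n * fact n \<le> fact (2 * n)\<close>.\<close>

lemma cosh_le_exp_half_square: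
  fixes x :: real
  shows "cosh x \<le> exp (x\<^sup>2 / 2)"
proof -
  have fact_le: "2 ^ n * fact n \<le> (fact (2 * n) :: real)" for n
  proof (induction n)
    case (Suc n)
    have "2 ^ Suc n * fact (Suc n) = (2 * (real n + 1)) * (2 ^ n * fact n)"
      by (simp add: algebra_simps)
    also have "\<dots> \<le> (2 * (real n + 1)) * fact (2 * n)"
      using Suc by (intro mult_left_mono) auto
    also have "\<dots> \<le> ((2 * real n + 1) * (2 * (real n + 1))) * fact (2 * n)"
      by (intro mult_right_mono) (auto simp: algebra_simps)
    also have "\<dots> = fact (2 * Suc n)"
      by (simp add: algebra_simps)
    finally show ?case .
  qed simp
  have exp: "(\<lambda>n. (x\<^sup>2 / 2) ^ n /\<^sub>R fact n) sums exp (x\<^sup>2 / 2)"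
    by (rule exp_converges)
  \<comment> \<open>The cosh series runs over all naturals with zero odd terms; reindexing along the
    even numbers aligns it with the other series.\<close>
  have cosh: "(\<lambda>n. x ^ (2 * n) /\<^sub>R fact (2 * n)) sums cosh x"
  proof -
    have "strict_mono (\<lambda>n::nat. 2 * n)"
      by (simp add: strict_mono_def)
    moreover have "n \<in> range (\<lambda>n::nat. 2 * n)" if "even n" for n :: nat
      using that by (auto elim!: evenE)
    ultimately have "(\<lambda>n. if even (2 * n) then x ^ (2 * n) /\<^sub>R fact (2 * n) else 0) sums cosh x"
      using cosh_converges[of x] by (subst (asm) sums_mono_reindex[symmetric, of "\<lambda>n. 2 * n"]) auto
    then show ?thesis by simp
  qed
  have "x ^ (2 * n) /\<^sub>R fact (2 * n) \<le> (x\<^sup>2 / 2) ^ n /\<^sub>R fact n" for n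
  proof -
    have "x ^ (2 * n) / fact (2 * n) \<le> x ^ (2 * n) / (2 ^ n * fact n)"
      using fact_le[of n] by (intro divide_left_mono) (auto simp: power_mult)
    then have "x ^ (2 * n) / fact (2 * n) \<le> (x\<^sup>2 / 2) ^ n / fact n"
      by (simp add: power_mult power_divide)
    then show ?thesis
      by (simp only: real_scaleR_def divide_inverse mult.commute)
  qed
  then show ?thesis
    using cosh exp by (rule sums_le)
qed

text \<open>Hoeffding's lemma: on \<open>[-1, 1]\<close> the convex function
  \<open>exp (s * y)\<close> lies below its chord, and the linear part of the chord sums to zero
  because the mean vanishes.\<close>

lemma sum_exp_mean_zero_le:
  fixes f :: "'i \<Rightarrow> real"
  assumes bound: "\<And>i. i \<in> I \<Longrightarrow> \<bar>f i\<bar> \<le> 1" and mean: "(\<Sum>i\<in>I. f i) = 0"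
  shows "(\<Sum>i\<in>I. exp (s * f i)) \<le> card I * exp (s\<^sup>2 / 2)"
proof -
  have chord: "exp (s * y) \<le> cosh s + y * sinh s" if "\<bar>y\<bar> \<le> 1" for y
  proof -
    have "exp ((1 - (1 + y) / 2) *\<^sub>R (- s) + ((1 + y) / 2) *\<^sub>R s)
        \<le> (1 - (1 + y) / 2) * exp (- s) + ((1 + y) / 2) * exp s"
      using that by (intro convex_onD[OF exp_convex]) auto
    moreover have "(1 - (1 + y) / 2) *\<^sub>R (- s) + ((1 + y) / 2) *\<^sub>R s = s * y"
      by (simp add: field_simps)
    ultimately show ?thesis
      by (simp add: cosh_field_def sinh_field_def field_simps)
  qed
  have "(\<Sum>i\<in>I. exp (s * f i)) \<le> (\<Sum>i\<in>I. cosh s + f i * sinh s)"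
    using bound by (intro sum_mono chord)
  also have "\<dots> = card I * cosh s"
    by (simp add: sum.distrib flip: sum_distrib_right) (simp add: mean)
  also have "\<dots> \<le> card I * exp (s\<^sup>2 / 2)"
    by (intro mult_left_mono cosh_le_exp_half_square) auto
  finally show ?thesis .
qed

text \<open>The constant is the maximum of \<open>t ^ (2 * m) * exp (- t)\<close> over
  \<open>t \<ge> 0\<close>, attained at \<open>t = 2 * m\<close>; the two exponentials together
  dominate \<open>exp \<bar>y\<bar>\<close>.\<close>

lemma even_power_le_exp:
  fixes y :: real
  assumes "m \<ge> 1"
  shows "y ^ (2 * m) \<le> (2 * m / exp 1) ^ (2 * m) * (exp y + exp (- y))"
proof -
  have "\<bar>y\<bar> / (2 * m) \<le> exp (\<bar>y\<bar> / (2 * m) - 1)"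
    using exp_ge_add_one_self[of "\<bar>y\<bar> / (2 * m) - 1"] by simp
  then have "\<bar>y\<bar> \<le> 2 * m / exp 1 * exp (\<bar>y\<bar> / (2 * m))"
    using assms by (simp add: exp_diff pos_divide_le_eq mult_ac)
  then have "\<bar>y\<bar> ^ (2 * m) \<le> (2 * m / exp 1 * exp (\<bar>y\<bar> / (2 * m))) ^ (2 * m)"
    by (intro power_mono) auto
  also have "\<dots> = (2 * m / exp 1) ^ (2 * m) * exp \<bar>y\<bar>"
    using assms by (simp only: power_mult_distrib exp_of_nat_mult[symmetric]) simp
  also have "\<dots> \<le> (2 * m / exp 1) ^ (2 * m) * (exp y + exp (- y))"
    by (intro mult_left_mono) (auto simp: abs_if)
  finally show ?thesis
    by (simp add: power_even_abs)
qed

text \<open>A Marcinkiewicz--Zygmund inequality, from the exponential moments at \<open>s = sqrt (2 m / k)\<close>.\<close>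

lemma sum_PiE_even_moment_le:
  fixes f :: "'a \<Rightarrow> real"
  assumes "finite A" "m \<ge> 1" "k \<ge> 1"
    and bound: "\<And>a. a \<in> A \<Longrightarrow> \<bar>f a\<bar> \<le> 1" and mean: "(\<Sum>a\<in>A. f a) = 0"
  shows "(\<Sum>w\<in>{..<k} \<rightarrow>\<^sub>E A. (\<Sum>i<k. f (w i)) ^ (2 * m)) \<le> real (card A) ^ k * (2 * m * k) ^ m"
proof -
  let ?P = "{..<k} \<rightarrow>\<^sub>E A"
  \<comment> \<open>With this \<open>s\<close> the factors \<open>exp (s\<^sup>2 / 2)\<close> of the
    \<open>k\<close> independent coordinates multiply up to \<open>exp m\<close>.\<close>
  define s where "s = sqrt (2 * m / k)"
  have s2: "s\<^sup>2 = 2 * m / k" and "s > 0"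
    using assms by (auto simp: s_def)
  \<comment> \<open>Independence of the coordinates turns the sum over tuples into a product. Both
    signs \<open>r = s\<close> and \<open>r = - s\<close> enter through
    \<open>even_power_le_exp\<close>.\<close>
  have exp_moment: "(\<Sum>w\<in>?P. exp (r * (\<Sum>i<k. f (w i)))) \<le> real (card A) ^ k * exp m"
    if "r\<^sup>2 = s\<^sup>2" for r
  proof -
    have "(\<Sum>w\<in>?P. exp (r * (\<Sum>i<k. f (w i)))) = (\<Sum>w\<in>?P. \<Prod>i<k. exp (r * f (w i)))"
      by (simp add: exp_sum sum_distrib_left)
    also have "\<dots> = (\<Prod>i<k. \<Sum>a\<in>A. exp (r * f a))"
      using assms by (intro prod_sum_PiE[symmetric]) auto
    also have "\<dots> \<le> (\<Prod>i<k. card A * exp (r\<^sup>2 / 2))"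
      using bound mean by (intro prod_mono conjI sum_exp_mean_zero_le sum_nonneg) auto
    also have "\<dots> = real (card A) ^ k * exp m"
      using \<open>k \<ge> 1\<close> by (simp add: power_mult_distrib that s2 flip: exp_of_nat_mult)
    finally show ?thesis .
  qed
  have "s ^ (2 * m) * (\<Sum>w\<in>?P. (\<Sum>i<k. f (w i)) ^ (2 * m)) =
      (\<Sum>w\<in>?P. (s * (\<Sum>i<k. f (w i))) ^ (2 * m))"
    by (simp only: power_mult_distrib sum_distrib_left[where A = ?P])
  also have "\<dots> \<le> (\<Sum>w\<in>?P. (2 * m / exp 1) ^ (2 * m) *
      (exp (s * (\<Sum>i<k. f (w i))) + exp (- s * (\<Sum>i<k. f (w i)))))"
    by (intro sum_mono order.trans[OF even_power_le_exp[OF \<open>m \<ge> 1\<close>]]) simp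
  also have "\<dots> \<le> (2 * m / exp 1) ^ (2 * m) * (2 * (real (card A) ^ k * exp m))"
    unfolding sum_distrib_left[symmetric] sum.distrib
    using exp_moment[of s] exp_moment[of "- s"] by (intro mult_left_mono) auto
  \<comment> \<open>Half of the factors of \<open>(2 * m) ^ (2 * m)\<close> become
    \<open>s ^ (2 * m) * k ^ m\<close>; the other half stays as \<open>(2 * m) ^ m\<close>.\<close>
  also have "\<dots> = real (card A) ^ k * real (2 * m) ^ m * s ^ (2 * m) * real k ^ m * (2 / exp m)"
  proof -
    have "exp (real m) ^ 2 = exp 1 ^ (2 * m)"
      by (simp flip: exp_of_nat_mult)
    then have "(2 * m / exp 1) ^ (2 * m) * (2 * exp m) = real (2 * m) ^ (2 * m) * (2 / exp m)"
      by (simp add: power_divide power2_eq_square field_simps)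
    moreover have "s ^ (2 * m) * real k ^ m = real (2 * m) ^ m"
      using \<open>k \<ge> 1\<close> by (simp add: power_mult s2 power_divide)
    ultimately have "(2 * m / exp 1) ^ (2 * m) * (2 * exp m) =
        real (2 * m) ^ m * (s ^ (2 * m) * real k ^ m) * (2 / exp m)"
      by (simp only: mult_2 power_add)
    then have "real (card A) ^ k * ((2 * m / exp 1) ^ (2 * m) * (2 * exp m)) =
        real (card A) ^ k * (real (2 * m) ^ m * (s ^ (2 * m) * real k ^ m) * (2 / exp m))"
      by (simp only:)
    then show ?thesis
      by (simp only: mult_ac)
  qed
  also have "\<dots> \<le> real (card A) ^ k * real (2 * m) ^ m * s ^ (2 * m) * real k ^ m * 1"
  proof -
    have "exp (real m) \<ge> 2"
      using exp_ge_add_one_self[of "real m"] \<open>m \<ge> 1\<close> by linarith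
    then show ?thesis
      using \<open>s > 0\<close> by (intro mult_left_mono) auto
  qed
  finally have "s ^ (2 * m) * (\<Sum>w\<in>?P. (\<Sum>i<k. f (w i)) ^ (2 * m)) \<le>
      s ^ (2 * m) * (real (card A) ^ k * (2 * m * k) ^ m)"
    by (simp add: mult_ac power_mult_distrib)
  then show ?thesis
    using \<open>s > 0\<close> by simp
qed

text \<open>Jensen's inequality for the convex function \<open>t ^ (2 * m)\<close>.\<close>

lemma power_even_mean_le:
  fixes f :: "'a \<Rightarrow> real"
  assumes "finite A" "A \<noteq> {}"
  shows "((\<Sum>a\<in>A. f a) / card A) ^ (2 * m) \<le> (\<Sum>a\<in>A. f a ^ (2 * m)) / card A"
  using convex_on_sum[OF assms convex_power_even[of "2 * m"], of "\<lambda>_. 1 / card A" f] assms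
  by (simp add: sum_divide_distrib)

text \<open>Convexity at the midpoint of \<open>x\<close> and \<open>- y\<close>; it serves as the
  triangle inequality for moments of order \<open>2 * m\<close>.\<close>

lemma power_even_diff_le:
  fixes x y :: real
  shows "2 * (x - y) ^ (2 * m) \<le> 2 ^ (2 * m) * (x ^ (2 * m) + y ^ (2 * m))"
proof -
  have "((x - y) / 2) ^ (2 * m) \<le> (x ^ (2 * m) + y ^ (2 * m)) / 2"
    using convex_onD[OF convex_power_even[of "2 * m"], of "1 / 2" x "- y"]
    by (simp add: diff_divide_distrib add_divide_distrib)
  then show ?thesis
    by (simp add: power_divide pos_divide_le_eq mult_ac)
qed

subsection \<open>Almost periods\<close>

locale finite_additive_group = abelian_group G for G (structure) +
  assumes finite_carrier [simp]: "finite (carrier G)"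
begin

lemma card_carrier_pos: "card (carrier G) > 0"
  using zero_closed by (auto simp: card_gt_0_iff)

lemma card_subset_carrier_pos:
  assumes "A \<subseteq> carrier G" "A \<noteq> {}"
  shows "card A > 0"
  using assms finite_subset[OF assms(1)] by (simp add: card_gt_0_iff)

lemma sum_carrier_shift:
  assumes "t \<in> carrier G"
  shows "(\<Sum>x\<in>carrier G. f (x \<oplus> t)) = (\<Sum>x\<in>carrier G. f x)"
  by (rule sum.reindex_bij_witness[of _ "\<lambda>x. x \<ominus> t" "\<lambda>x. x \<oplus> t"])
    (use assms in \<open>auto simp: a_minus_def a_assoc l_neg r_neg\<close>)

text \<open>Convolution of \<open>f\<close> with the uniform probability measure on
  \<open>- A\<close>.\<close>

definition mean_shift :: "'a set \<Rightarrow> ('a \<Rightarrow> real) \<Rightarrow> 'a \<Rightarrow> real" where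
  "mean_shift A f x = (\<Sum>a\<in>A. f (x \<oplus> a)) / card A"

lemma mean_shift_bounds:
  assumes "A \<subseteq> carrier G" "A \<noteq> {}" "x \<in> carrier G"
    and "\<And>y. y \<in> carrier G \<Longrightarrow> l \<le> f y \<and> f y \<le> u"
  shows "l \<le> mean_shift A f x \<and> mean_shift A f x \<le> u"
proof -
  have cA: "card A > 0"
    using assms by (intro card_subset_carrier_pos)
  have "l \<le> f (x \<oplus> a) \<and> f (x \<oplus> a) \<le> u" if "a \<in> A" for a
    using assms that by (intro assms(4)) auto
  then have "card A * l \<le> (\<Sum>a\<in>A. f (x \<oplus> a)) \<and> (\<Sum>a\<in>A. f (x \<oplus> a)) \<le> card A * u"
    by (intro conjI sum_bounded_below sum_bounded_above) auto
  then show ?thesis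
    using cA by (auto simp: mean_shift_def field_simps)
qed

text \<open>Double counting: for each \<open>t\<close> translation by \<open>- t\<close> permutes
  the \<open>k\<close>-tuples, so exactly \<open>card L\<close> tuples \<open>y\<close> are carried
  into \<open>L\<close>. The best \<open>y\<close> reaches at least the average over all
  tuples.\<close>

lemma ex_popular_shift:
  assumes L: "L \<subseteq> {..<k} \<rightarrow>\<^sub>E carrier G"
  obtains y where "y \<in> {..<k} \<rightarrow>\<^sub>E carrier G"
    "card (carrier G) * card L
      \<le> card (carrier G) ^ k * card {t \<in> carrier G. (\<lambda>i\<in>{..<k}. y i \<ominus> t) \<in> L}"
proof -
  let ?Y = "{..<k} \<rightarrow>\<^sub>E carrier G"
  let ?T = "\<lambda>y. {t \<in> carrier G. (\<lambda>i\<in>{..<k}. y i \<ominus> t) \<in> L}"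
  have finY: "finite ?Y"
    by (intro finite_PiE) auto
  have bij: "bij_betw (\<lambda>y. \<lambda>i\<in>{..<k}. y i \<ominus> t) {y \<in> ?Y. (\<lambda>i\<in>{..<k}. y i \<ominus> t) \<in> L} L"
    if t: "t \<in> carrier G" for t
  proof (rule bij_betw_byWitness[where f' = "\<lambda>w. \<lambda>i\<in>{..<k}. w i \<oplus> t"])
    have inv: "(\<lambda>i\<in>{..<k}. (\<lambda>i\<in>{..<k}. w i \<oplus> t) i \<ominus> t) = w"
      and inv': "(\<lambda>i\<in>{..<k}. (\<lambda>i\<in>{..<k}. w i \<ominus> t) i \<oplus> t) = w" if "w \<in> ?Y" for w
      using that t
      by (auto simp: fun_eq_iff PiE_iff extensional_def a_minus_def a_assoc l_neg r_neg)
    show "\<forall>y\<in>{y \<in> ?Y. (\<lambda>i\<in>{..<k}. y i \<ominus> t) \<in> L}.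
        (\<lambda>i\<in>{..<k}. (\<lambda>i\<in>{..<k}. y i \<ominus> t) i \<oplus> t) = y"
      using inv' by blast
    show "\<forall>w\<in>L. (\<lambda>i\<in>{..<k}. (\<lambda>i\<in>{..<k}. w i \<oplus> t) i \<ominus> t) = w"
      using inv L by blast
    show "(\<lambda>w. \<lambda>i\<in>{..<k}. w i \<oplus> t) ` L \<subseteq> {y \<in> ?Y. (\<lambda>i\<in>{..<k}. y i \<ominus> t) \<in> L}"
    proof (rule image_subsetI)
      fix w assume w: "w \<in> L"
      then have wY: "w \<in> ?Y"
        using L by auto
      then have "(\<lambda>i\<in>{..<k}. w i \<oplus> t) \<in> ?Y"
        using t by auto
      then show "(\<lambda>i\<in>{..<k}. w i \<oplus> t) \<in> {y \<in> ?Y. (\<lambda>i\<in>{..<k}. y i \<ominus> t) \<in> L}"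
        unfolding mem_Collect_eq inv[OF wY] using w by blast
    qed
  qed auto
  have "(\<Sum>y\<in>?Y. card (?T y)) = (\<Sum>y\<in>?Y. \<Sum>t\<in>carrier G. of_bool ((\<lambda>i\<in>{..<k}. y i \<ominus> t) \<in> L))"
    by (simp add: of_bool_def sum.If_cases Int_def)
  also have "\<dots> = (\<Sum>t\<in>carrier G. card {y \<in> ?Y. (\<lambda>i\<in>{..<k}. y i \<ominus> t) \<in> L})"
    by (subst sum.swap) (simp add: of_bool_def sum.If_cases Int_def finY)
  also have "\<dots> = card (carrier G) * card L"
    by (simp add: bij_betw_same_card[OF bij])
  finally have total: "(\<Sum>y\<in>?Y. card (?T y)) = card (carrier G) * card L" .
  have Y0: "(\<lambda>i\<in>{..<k}. \<zero>) \<in> ?Y"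
    by auto
  obtain y where y: "y \<in> ?Y" "card (?T y) = Max ((\<lambda>y. card (?T y)) ` ?Y)"
    using Max_in[of "(\<lambda>y. card (?T y)) ` ?Y"] finY Y0 by fastforce
  have "(\<Sum>y\<in>?Y. card (?T y)) \<le> card ?Y * card (?T y)"
    using sum_bounded_above[of ?Y "\<lambda>y. card (?T y)" "card (?T y)"] finY
    by (simp add: y(2))
  then show thesis
    using that[OF y(1)] by (simp add: total card_PiE)
qed

text \<open>
  Croot and Sisask: a random \<open>k\<close>-tuple from \<open>A\<close> samples the average \<open>mean_shift A f\<close> well in
  \<open>L\<^sup>2\<^sup>m\<close>. By pigeonhole many translates of one fixed tuple are good samples, and two such
  translates differ by an almost period.
\<close>

theorem croot_sisask:
  fixes f :: "'a \<Rightarrow> real" and \<delta> :: real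
  assumes A: "A \<subseteq> carrier G" "A \<noteq> {}" and mk: "m \<ge> 1" "k \<ge> 1"
    and f: "\<And>x. x \<in> carrier G \<Longrightarrow> 0 \<le> f x \<and> f x \<le> 1"
    and "\<delta> \<ge> 0" and \<delta>: "2 * card (carrier G) * (8 * m / k) ^ m \<le> card A * \<delta> ^ (2 * m)"
  obtains X where "X \<subseteq> carrier G"
    "real (card A) ^ k * card (carrier G) \<le> 2 * real (card (carrier G)) ^ k * card X"
    "\<And>x h. x \<in> X \<Longrightarrow> h \<in> carrier G \<Longrightarrow>
      \<bar>mean_shift A (mean_shift A f) (h \<oplus> x) - mean_shift A (mean_shift A f) h\<bar> \<le> \<delta>"
proof -
  define F where "F = mean_shift A f"
  define N where "N = card (carrier G)"
  \<comment> \<open>The sampling error of the tuple \<open>w\<close>, scaled by \<open>k\<close> and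
    measured as a moment over the whole group.\<close>
  define dev where "dev w = (\<Sum>x\<in>carrier G. (\<Sum>i<k. f (x \<oplus> w i) - F x) ^ (2 * m))" for w
  \<comment> \<open>\<open>B\<close> bounds the mean of \<open>dev\<close> over \<open>?P\<close>,
    so by Markov's inequality at least half of all tuples have error at most
    \<open>2 * B\<close>.\<close>
  define B where "B = real N * (2 * m * k) ^ m"
  let ?P = "{..<k} \<rightarrow>\<^sub>E A"
  define L where "L = {w \<in> ?P. dev w \<le> 2 * B}"
  have "N > 0"
    using card_carrier_pos by (simp add: N_def)
  have finA: "finite A" and cA: "card A > 0"
    using finite_subset[OF A(1)] card_subset_carrier_pos[OF A] by auto
  have finP: "finite ?P"
    using finA by (intro finite_PiE) auto
  have "B > 0"
    using \<open>N > 0\<close> mk by (auto simp: B_def)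
  have dev_nonneg: "dev w \<ge> 0" for w
    by (auto simp: dev_def intro!: sum_nonneg zero_le_even_power)

  have "(\<Sum>w\<in>?P. dev w) = (\<Sum>x\<in>carrier G. \<Sum>w\<in>?P. (\<Sum>i<k. f (x \<oplus> w i) - F x) ^ (2 * m))"
    unfolding dev_def by (rule sum.swap)
  also have "\<dots> \<le> (\<Sum>x\<in>carrier G. real (card A) ^ k * (2 * m * k) ^ m)"
  proof (intro sum_mono sum_PiE_even_moment_le[OF finA mk])
    fix x assume x: "x \<in> carrier G"
    show "(\<Sum>a\<in>A. f (x \<oplus> a) - F x) = 0"
      using cA by (simp add: sum_subtractf F_def mean_shift_def)
    fix a assume a: "a \<in> A"
    have "0 \<le> F x \<and> F x \<le> 1"
      unfolding F_def using A x f by (intro mean_shift_bounds) auto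
    moreover have "0 \<le> f (x \<oplus> a) \<and> f (x \<oplus> a) \<le> 1"
      using A a x by (intro f) auto
    ultimately show "\<bar>f (x \<oplus> a) - F x\<bar> \<le> 1"
      by linarith
  qed
  also have "\<dots> = real (card A) ^ k * B"
    by (simp add: B_def N_def)
  finally have total: "(\<Sum>w\<in>?P. dev w) \<le> real (card A) ^ k * B" .
  have "2 * B \<le> dev w" if "w \<in> ?P - L" for w
    using that unfolding L_def by (metis (no_types, lifting) DiffE linorder_le_cases mem_Collect_eq)
  then have "card (?P - L) * (2 * B) \<le> (\<Sum>w\<in>?P - L. dev w)"
    by (rule sum_bounded_below)
  also have "\<dots> \<le> (\<Sum>w\<in>?P. dev w)"
    using finP dev_nonneg by (intro sum_mono2) auto
  finally have "(2 * real (card (?P - L))) * B \<le> real (card A) ^ k * B"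
    using total by (simp add: mult_ac)
  then have "2 * real (card (?P - L)) \<le> real (card A) ^ k"
    using \<open>B > 0\<close> by simp
  moreover have "card (?P - L) + card L = card A ^ k"
    using finP card_Diff_subset[of L ?P] card_mono[of ?P L] finite_subset[of L ?P]
    by (auto simp: L_def card_PiE)
  then have "real (card (?P - L)) + real (card L) = real (card A) ^ k"
    by (metis of_nat_add of_nat_power)
  ultimately have cL: "real (card A) ^ k \<le> 2 * card L"
    by linarith

  have "L \<subseteq> {..<k} \<rightarrow>\<^sub>E carrier G"
    using A(1) PiE_mono[of "{..<k}" "\<lambda>_. A" "\<lambda>_. carrier G"] by (auto simp: L_def)
  then obtain y where y: "y \<in> {..<k} \<rightarrow>\<^sub>E carrier G"
    and cT: "N * card L \<le> N ^ k * card {t \<in> carrier G. (\<lambda>i\<in>{..<k}. y i \<ominus> t) \<in> L}"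
    unfolding N_def by (rule ex_popular_shift)
  define T where "T = {t \<in> carrier G. (\<lambda>i\<in>{..<k}. y i \<ominus> t) \<in> L}"
  define g where "g x = (\<Sum>i<k. f (x \<oplus> y i))" for x
  \<comment> \<open>Replacing \<open>x\<close> by \<open>x \<oplus> t\<close> turns the translated
    tuple back into \<open>y\<close>. Hence one function \<open>g\<close> approximates
    \<open>k\<close> times the translate of \<open>F\<close> by \<open>t\<close> for every
    \<open>t \<in> T\<close>.\<close>
  have sample: "(\<Sum>x\<in>carrier G. (g x - k * F (x \<oplus> t)) ^ (2 * m)) \<le> 2 * B" if "t \<in> T" for t
  proof -
    have t: "t \<in> carrier G" "dev (\<lambda>i\<in>{..<k}. y i \<ominus> t) \<le> 2 * B"
      using that by (auto simp: T_def L_def)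
    have "dev (\<lambda>i\<in>{..<k}. y i \<ominus> t) =
        (\<Sum>x\<in>carrier G. (\<Sum>i<k. f ((x \<oplus> t) \<oplus> (y i \<ominus> t)) - F (x \<oplus> t)) ^ (2 * m))"
      unfolding dev_def by (subst sum_carrier_shift[OF t(1), symmetric]) simp
    also have "\<dots> = (\<Sum>x\<in>carrier G. (g x - k * F (x \<oplus> t)) ^ (2 * m))"
    proof (rule sum.cong[OF refl])
      fix x assume x: "x \<in> carrier G"
      have "(x \<oplus> t) \<oplus> (y i \<ominus> t) = x \<oplus> y i" if "i < k" for i
      proof -
        have "y i \<in> carrier G"
          using y that by auto
        then have "(x \<oplus> t) \<oplus> (y i \<ominus> t) = (x \<oplus> y i) \<oplus> (t \<oplus> \<ominus> t)"
          using x t(1) by (simp add: a_minus_def a_ac)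
        then show ?thesis
          using \<open>y i \<in> carrier G\<close> x t(1) by (simp add: r_neg)
      qed
      then show "(\<Sum>i<k. f ((x \<oplus> t) \<oplus> (y i \<ominus> t)) - F (x \<oplus> t)) ^ (2 * m) =
          (g x - k * F (x \<oplus> t)) ^ (2 * m)"
        by (simp add: g_def sum_subtractf)
    qed
    finally show ?thesis
      using t(2) by simp
  qed

  \<comment> \<open>Two translates of \<open>F\<close> are compared through their common
    approximation \<open>g\<close>; the hypothesis on \<delta> absorbs the resulting
    constant.\<close>
  have diff: "(\<Sum>x\<in>carrier G. (F (x \<oplus> t) - F (x \<oplus> t')) ^ (2 * m)) \<le> card A * \<delta> ^ (2 * m)"
    if "t \<in> T" "t' \<in> T" for t t'
  proof -
    have "2 * real k ^ (2 * m) * (\<Sum>x\<in>carrier G. (F (x \<oplus> t) - F (x \<oplus> t')) ^ (2 * m)) =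
        (\<Sum>x\<in>carrier G. 2 * ((g x - k * F (x \<oplus> t')) - (g x - k * F (x \<oplus> t))) ^ (2 * m))"
      by (simp add: sum_distrib_left mult.assoc flip: power_mult_distrib right_diff_distrib)
    also have "\<dots> \<le> (\<Sum>x\<in>carrier G. 2 ^ (2 * m) *
        ((g x - k * F (x \<oplus> t')) ^ (2 * m) + (g x - k * F (x \<oplus> t)) ^ (2 * m)))"
      by (intro sum_mono power_even_diff_le)
    also have "\<dots> \<le> 2 ^ (2 * m) * (2 * B + 2 * B)"
      unfolding sum_distrib_left[symmetric] sum.distrib
      using sample that by (intro mult_left_mono add_mono) auto
    also have "\<dots> = 2 * real k ^ (2 * m) * (2 * N * (8 * m / k) ^ m)"
    proof -
      have "(2::real) ^ (2 * m) * (2 * real m * real k) ^ m = (4 * (2 * real m * real k)) ^ m"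
        by (simp only: power_mult power_mult_distrib) simp
      also have "\<dots> = (real k ^ 2 * (8 * real m / real k)) ^ m"
        using mk by (simp add: power2_eq_square mult_ac)
      also have "\<dots> = real k ^ (2 * m) * (8 * real m / real k) ^ m"
        by (simp only: power_mult power_mult_distrib)
      finally have "(2::real) ^ (2 * m) * (2 * real m * real k) ^ m = real k ^ (2 * m) * (8 * real m / real k) ^ m" .
      then have "4 * real N * ((2::real) ^ (2 * m) * (2 * real m * real k) ^ m) =
          4 * real N * (real k ^ (2 * m) * (8 * real m / real k) ^ m)"
        by (simp only:)
      then show ?thesis
        by (simp add: B_def mult_ac)
    qed
    also have "\<dots> \<le> 2 * real k ^ (2 * m) * (card A * \<delta> ^ (2 * m))"
      using \<delta> by (intro mult_left_mono) (auto simp: N_def)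
    finally show ?thesis
      using mk by simp
  qed

  have large: "2 * real N ^ k * card T \<ge> real (card A) ^ k * N"
  proof -
    have "real (N * card L) \<le> real (N ^ k * card T)"
      using cT unfolding T_def of_nat_le_iff .
    then have "real N * card L \<le> real N ^ k * card T"
      by simp
    then show ?thesis
      using mult_right_mono[OF cL, of "real N"] by (simp add: mult_ac)
  qed
  have "0 < real (card A) ^ k * N"
    using cA \<open>N > 0\<close> by simp
  with large have "T \<noteq> {}"
    by auto
  then obtain t' where t': "t' \<in> T"
    by blast
  have T_carrier: "T \<subseteq> carrier G"
    by (auto simp: T_def)
  \<comment> \<open>Subtracting one fixed \<open>t'\<close> preserves the size of \<open>T\<close>,
    and differences of good translates are almost periods.\<close>
  define X where "X = (\<lambda>t. t \<ominus> t') ` T"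
  have "inj_on (\<lambda>t. t \<ominus> t') T"
    using T_carrier t' by (intro inj_onI) (auto simp: a_minus_def subset_iff)
  then have "card X = card T"
    unfolding X_def by (rule card_image)
  moreover have "X \<subseteq> carrier G"
    using T_carrier t' by (auto simp: X_def)
  moreover have "\<bar>mean_shift A F (h \<oplus> x) - mean_shift A F h\<bar> \<le> \<delta>"
    if x: "x \<in> X" and h: "h \<in> carrier G" for x h
  proof -
    obtain t where t: "t \<in> T" "x = t \<ominus> t'"
      using x by (auto simp: X_def)
    have tt: "t \<in> carrier G" "t' \<in> carrier G"
      using T_carrier t t' by auto
    let ?u = "\<lambda>a. F (h \<oplus> x \<oplus> a) - F (h \<oplus> a)"
    let ?v = "\<lambda>x. F (x \<oplus> t) - F (x \<oplus> t')"
    \<comment> \<open>The outer average over \<open>A\<close> makes the moment bound pointwise: by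
      Jensen the difference is controlled by a sum over a translate of \<open>A\<close>, hence by
      the sum over the group, and dividing by \<open>card A\<close> cancels the factor in
      \<open>diff\<close>.\<close>
    have "(mean_shift A F (h \<oplus> x) - mean_shift A F h) ^ (2 * m) =
        ((\<Sum>a\<in>A. ?u a) / card A) ^ (2 * m)"
      by (simp add: mean_shift_def sum_subtractf diff_divide_distrib)
    also have "\<dots> \<le> (\<Sum>a\<in>A. ?u a ^ (2 * m)) / card A"
      by (rule power_even_mean_le[OF finA A(2)])
    also have "(\<Sum>a\<in>A. ?u a ^ (2 * m)) = (\<Sum>a\<in>A. ?v (h \<oplus> a \<ominus> t') ^ (2 * m))"
    proof (rule sum.cong[OF refl])
      fix a assume "a \<in> A"
      then have a: "a \<in> carrier G"
        using A by auto
      have "h \<oplus> a \<ominus> t' \<oplus> t = h \<oplus> x \<oplus> a" "h \<oplus> a \<ominus> t' \<oplus> t' = h \<oplus> a"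
        using a tt h by (auto simp: t(2) a_minus_def a_ac l_neg r_neg)
      then show "?u a ^ (2 * m) = ?v (h \<oplus> a \<ominus> t') ^ (2 * m)"
        by simp
    qed
    also have "\<dots> = (\<Sum>x\<in>(\<lambda>a. h \<oplus> a \<ominus> t') ` A. ?v x ^ (2 * m))"
      using A tt h
      by (subst sum.reindex) (auto intro!: inj_onI simp: a_minus_def a_assoc subset_iff)
    also have "\<dots> \<le> (\<Sum>x\<in>carrier G. ?v x ^ (2 * m))"
      using A tt h by (intro sum_mono2) (auto simp: zero_le_even_power)
    also have "\<dots> \<le> card A * \<delta> ^ (2 * m)"
      using t t' by (intro diff)
    finally have "\<bar>mean_shift A F (h \<oplus> x) - mean_shift A F h\<bar> ^ (2 * m) \<le> \<delta> ^ (2 * m)"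
      using cA by (simp add: power_even_abs divide_right_mono)
    then show ?thesis
      using \<open>\<delta> \<ge> 0\<close> mk by (subst (asm) power_mono_iff) auto
  qed
  ultimately show thesis
    using that[of X] large by (simp add: F_def N_def)
qed

text \<open>Each further average over \<open>X\<close> moves the argument by one almost period and
  so costs one more \<delta>.\<close>

lemma mean_shift_iterate_close:
  fixes \<delta> :: real
  assumes X: "X \<subseteq> carrier G" "X \<noteq> {}"
    and close: "\<And>x h. x \<in> X \<Longrightarrow> h \<in> carrier G \<Longrightarrow> \<bar>f (h \<oplus> x) - f h\<bar> \<le> \<delta>"
    and "h \<in> carrier G"
  shows "\<bar>(mean_shift X ^^ l) f h - f h\<bar> \<le> l * \<delta>"
  using \<open>h \<in> carrier G\<close>
proof (induction l arbitrary: h)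
  case (Suc l)
  have cX: "card X > 0"
    using card_subset_carrier_pos[OF X] .
  let ?g = "(mean_shift X ^^ l) f"
  have step: "\<bar>?g (h \<oplus> x) - f h\<bar> \<le> (l + 1) * \<delta>" if "x \<in> X" for x
  proof -
    have "\<bar>?g (h \<oplus> x) - f (h \<oplus> x)\<bar> \<le> l * \<delta>"
      using Suc that X by auto
    moreover have "\<bar>f (h \<oplus> x) - f h\<bar> \<le> \<delta>"
      using close Suc that by auto
    ultimately show ?thesis
      by (simp add: algebra_simps)
  qed
  have "(mean_shift X ^^ Suc l) f h - f h = (\<Sum>x\<in>X. ?g (h \<oplus> x) - f h) / card X"
    using cX by (simp add: mean_shift_def sum_subtractf diff_divide_distrib)
  also have "\<bar>\<dots>\<bar> \<le> (\<Sum>x\<in>X. \<bar>?g (h \<oplus> x) - f h\<bar>) / card X"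
    by (simp add: divide_right_mono)
  also have "\<dots> \<le> (card X * ((l + 1) * \<delta>)) / card X"
    using step by (intro divide_right_mono sum_bounded_above) auto
  also have "\<dots> = Suc l * \<delta>"
    using cX by simp
  finally show ?case .
qed simp

text \<open>A shift by \<open>a\<close> replaces the translate of \<open>V\<close> by
  \<open>x\<close> with the translate by \<open>x \<oplus> a\<close>, so a bound uniform in the
  translate survives averaging.\<close>

lemma sum_mean_shift_le:
  assumes "A \<subseteq> carrier G" "A \<noteq> {}" "V \<subseteq> carrier G" "x \<in> carrier G"
    and "\<And>x. x \<in> carrier G \<Longrightarrow> (\<Sum>v\<in>V. f (x \<oplus> v)) \<le> c"
  shows "(\<Sum>v\<in>V. mean_shift A f (x \<oplus> v)) \<le> c"
proof -
  have cA: "card A > 0"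
    using card_subset_carrier_pos[OF assms(1,2)] .
  have "(\<Sum>v\<in>V. mean_shift A f (x \<oplus> v)) = (\<Sum>a\<in>A. \<Sum>v\<in>V. f (x \<oplus> v \<oplus> a)) / card A"
    by (subst sum.swap) (simp add: mean_shift_def sum_divide_distrib)
  also have "(\<Sum>a\<in>A. \<Sum>v\<in>V. f (x \<oplus> v \<oplus> a)) = (\<Sum>a\<in>A. \<Sum>v\<in>V. f (x \<oplus> a \<oplus> v))"
    using assms(1,3,4) by (intro sum.cong refl arg_cong[of _ _ f]) (auto simp: a_ac subset_iff)
  also have "\<dots> \<le> card A * c"
    using assms by (intro sum_bounded_above) auto
  finally show ?thesis
    using cA by (simp add: divide_right_mono)
qed

end

subsection \<open>Fourier analysis with a complete family of characters\<close>

lemma sum_roots_unity_powers: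
  fixes z :: "'a :: field"
  assumes "z ^ q = 1" "z \<noteq> 1"
  shows "(\<Sum>u<q. z ^ u) = 0"
  using assms by (simp add: geometric_sum)

text \<open>Completeness is encoded as \<open>sum_chi\<close>, orthogonality summed over the
  characters; it yields both Parseval and inversion. The number \<open>q\<close> is a common
  exponent, so all values are roots of unity of order dividing \<open>q\<close>.\<close>

locale complete_characters = finite_additive_group G for G (structure) +
  fixes \<Xi> :: "'x set" and \<chi> :: "'x \<Rightarrow> 'a \<Rightarrow> complex" and q :: nat
  assumes finite_\<Xi> [simp]: "finite \<Xi>"
    and q_pos: "q > 0"
    and chi_add: "\<lbrakk>\<xi> \<in> \<Xi>; x \<in> carrier G; y \<in> carrier G\<rbrakk> \<Longrightarrow> \<chi> \<xi> (x \<oplus> y) = \<chi> \<xi> x * \<chi> \<xi> y"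
    and chi_power: "\<lbrakk>\<xi> \<in> \<Xi>; x \<in> carrier G\<rbrakk> \<Longrightarrow> \<chi> \<xi> x ^ q = 1"
    and sum_chi: "x \<in> carrier G \<Longrightarrow> (\<Sum>\<xi>\<in>\<Xi>. \<chi> \<xi> x) = (if x = \<zero> then of_nat (card (carrier G)) else 0)"
begin

lemma diff_eq_zero_iff:
  assumes "a \<in> carrier G" "b \<in> carrier G"
  shows "a \<ominus> b = \<zero> \<longleftrightarrow> a = b"
proof
  assume "a \<ominus> b = \<zero>"
  then have "a \<oplus> (\<ominus> b \<oplus> b) = \<zero> \<oplus> b"
    using assms by (simp add: a_minus_def flip: a_assoc)
  then show "a = b"
    using assms by (simp add: l_neg)
qed (use assms in \<open>simp add: a_minus_def r_neg\<close>)

lemma norm_chi [simp]: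
  assumes "\<xi> \<in> \<Xi>" "x \<in> carrier G"
  shows "norm (\<chi> \<xi> x) = 1"
proof -
  have "norm (\<chi> \<xi> x) ^ q = 1 ^ q"
    using chi_power[OF assms] by (simp flip: norm_power)
  then show ?thesis
    using q_pos by (metis norm_ge_zero power_eq_imp_eq_base zero_le_one)
qed

lemma chi_zero [simp]:
  assumes "\<xi> \<in> \<Xi>"
  shows "\<chi> \<xi> \<zero> = 1"
proof -
  have "\<chi> \<xi> \<zero> * \<chi> \<xi> \<zero> = \<chi> \<xi> \<zero> * 1"
    using chi_add[OF assms, of \<zero> \<zero>] by simp
  moreover have "\<chi> \<xi> \<zero> \<noteq> 0"
    using norm_chi[OF assms, of \<zero>] by force
  ultimately show ?thesis
    by simp
qed

lemma chi_minus:
  assumes "\<xi> \<in> \<Xi>" "x \<in> carrier G"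
  shows "\<chi> \<xi> (\<ominus> x) = cnj (\<chi> \<xi> x)"
proof -
  have "\<chi> \<xi> x * \<chi> \<xi> (\<ominus> x) = 1"
    using assms by (simp add: r_neg flip: chi_add)
  moreover have "\<chi> \<xi> x * cnj (\<chi> \<xi> x) = 1"
    using assms by (simp flip: complex_norm_square)
  moreover have "\<chi> \<xi> x \<noteq> 0"
    using norm_chi[OF assms] by force
  ultimately show ?thesis
    by (metis mult_left_cancel)
qed

text \<open>The transform of the indicator of \<open>A\<close>, unnormalised and without
  conjugation, so that \<open>hat A \<xi> / card A\<close> is the multiplier of
  \<open>mean_shift A\<close>.\<close>

definition hat :: "'a set \<Rightarrow> 'x \<Rightarrow> complex" where
  "hat A \<xi> = (\<Sum>a\<in>A. \<chi> \<xi> a)"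

text \<open>Expanding the square gives the characters at \<open>a \<ominus> b\<close>, and only the
  diagonal survives \<open>sum_chi\<close>.\<close>

lemma parseval:
  assumes A: "A \<subseteq> carrier G"
  shows "(\<Sum>\<xi>\<in>\<Xi>. (norm (hat A \<xi>))\<^sup>2) = card (carrier G) * card A"
proof -
  have finA: "finite A"
    using finite_subset[OF A] by simp
  have sum_diff: "(\<Sum>\<xi>\<in>\<Xi>. \<chi> \<xi> a * cnj (\<chi> \<xi> b)) =
      (if a = b then of_nat (card (carrier G)) else 0)" if "a \<in> A" "b \<in> A" for a b
  proof -
    have ab: "a \<in> carrier G" "b \<in> carrier G"
      using A that by auto
    have "(\<Sum>\<xi>\<in>\<Xi>. \<chi> \<xi> a * cnj (\<chi> \<xi> b)) = (\<Sum>\<xi>\<in>\<Xi>. \<chi> \<xi> (a \<ominus> b))"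
      using ab by (intro sum.cong) (auto simp: a_minus_def chi_add chi_minus)
    also have "\<dots> = (if a \<ominus> b = \<zero> then of_nat (card (carrier G)) else 0)"
      using ab by (intro sum_chi) auto
    also have "a \<ominus> b = \<zero> \<longleftrightarrow> a = b"
      by (rule diff_eq_zero_iff[OF ab])
    finally show ?thesis .
  qed
  have "complex_of_real (\<Sum>\<xi>\<in>\<Xi>. (norm (hat A \<xi>))\<^sup>2) =
      (\<Sum>\<xi>\<in>\<Xi>. \<Sum>a\<in>A. \<Sum>b\<in>A. \<chi> \<xi> a * cnj (\<chi> \<xi> b))"
    by (simp add: complex_norm_square hat_def sum_product del: of_real_power)
  also have "\<dots> = (\<Sum>a\<in>A. \<Sum>b\<in>A. \<Sum>\<xi>\<in>\<Xi>. \<chi> \<xi> a * cnj (\<chi> \<xi> b))"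
    by (subst sum.swap, intro sum.cong refl, rule sum.swap)
  also have "\<dots> = (\<Sum>a\<in>A. \<Sum>b\<in>A. if a = b then of_nat (card (carrier G)) else 0)"
    by (intro sum.cong refl sum_diff)
  also have "\<dots> = complex_of_real (card (carrier G) * card A)"
    using finA by simp
  finally show ?thesis
    by (simp only: of_real_eq_iff)
qed

lemma fourier_inversion:
  fixes f :: "'a \<Rightarrow> real"
  assumes x: "x \<in> carrier G"
  shows "complex_of_real (f x) =
    (\<Sum>\<xi>\<in>\<Xi>. (\<Sum>s\<in>carrier G. f s * \<chi> \<xi> (\<ominus> s)) / card (carrier G) * \<chi> \<xi> x)"
proof -
  have "(\<Sum>\<xi>\<in>\<Xi>. (\<Sum>s\<in>carrier G. f s * \<chi> \<xi> (\<ominus> s)) / card (carrier G) * \<chi> \<xi> x) =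
      (\<Sum>\<xi>\<in>\<Xi>. \<Sum>s\<in>carrier G. f s / card (carrier G) * \<chi> \<xi> (x \<ominus> s))"
    using x by (intro sum.cong refl)
      (simp add: sum_divide_distrib sum_distrib_left a_minus_def chi_add mult_ac)
  also have "\<dots> = (\<Sum>s\<in>carrier G. f s / card (carrier G) * (\<Sum>\<xi>\<in>\<Xi>. \<chi> \<xi> (x \<ominus> s)))"
    by (subst sum.swap) (simp add: sum_distrib_left)
  also have "\<dots> = (\<Sum>s\<in>carrier G. if s = x then complex_of_real (f s) else 0)"
  proof (intro sum.cong refl)
    fix s assume s: "s \<in> carrier G"
    then have "(\<Sum>\<xi>\<in>\<Xi>. \<chi> \<xi> (x \<ominus> s)) = (if x \<ominus> s = \<zero> then of_nat (card (carrier G)) else 0)"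
      using x by (intro sum_chi) auto
    moreover have "x \<ominus> s = \<zero> \<longleftrightarrow> s = x"
      using diff_eq_zero_iff[OF x s] by auto
    ultimately show "f s / card (carrier G) * (\<Sum>\<xi>\<in>\<Xi>. \<chi> \<xi> (x \<ominus> s)) =
        (if s = x then complex_of_real (f s) else 0)"
      using card_carrier_pos by (simp del: card_eq_0_iff card_0_eq)
  qed
  also have "\<dots> = complex_of_real (f x)"
    using x by simp
  finally show ?thesis
    by simp
qed

text \<open>Averaging acts diagonally on characters. Any expansion of \<open>f\<close> is allowed,
  so the statement can be iterated.\<close>

lemma mean_shift_fourier:
  assumes "A \<subseteq> carrier G" "x \<in> carrier G"
    and f: "\<And>x. x \<in> carrier G \<Longrightarrow> complex_of_real (f x) = (\<Sum>\<xi>\<in>\<Xi>. c \<xi> * \<chi> \<xi> x)"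
  shows "complex_of_real (mean_shift A f x) = (\<Sum>\<xi>\<in>\<Xi>. c \<xi> * (hat A \<xi> / card A) * \<chi> \<xi> x)"
proof -
  have "complex_of_real (mean_shift A f x) = (\<Sum>a\<in>A. complex_of_real (f (x \<oplus> a))) / card A"
    by (simp add: mean_shift_def)
  also have "(\<Sum>a\<in>A. complex_of_real (f (x \<oplus> a))) = (\<Sum>a\<in>A. \<Sum>\<xi>\<in>\<Xi>. c \<xi> * \<chi> \<xi> (x \<oplus> a))"
    using assms by (intro sum.cong refl f) auto
  also have "\<dots> = (\<Sum>a\<in>A. \<Sum>\<xi>\<in>\<Xi>. c \<xi> * \<chi> \<xi> a * \<chi> \<xi> x)"
    using assms by (intro sum.cong refl) (auto simp: chi_add subset_iff)
  also have "\<dots> = (\<Sum>\<xi>\<in>\<Xi>. c \<xi> * hat A \<xi> * \<chi> \<xi> x)"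
    by (subst sum.swap) (simp add: hat_def sum_distrib_left sum_distrib_right)
  finally show ?thesis
    by (simp add: sum_divide_distrib)
qed

section \<open>Common kernels of characters and averages over them\<close>

definition annihilator :: "'x set \<Rightarrow> 'a set" where
  "annihilator \<Lambda> = {v \<in> carrier G. \<forall>\<xi>\<in>\<Lambda>. \<chi> \<xi> v = 1}"

lemma annihilator_subset: "annihilator \<Lambda> \<subseteq> carrier G"
  by (auto simp: annihilator_def)

lemma finite_annihilator [simp]: "finite (annihilator \<Lambda>)"
  using finite_subset[OF annihilator_subset] by simp

lemma annihilator_zero: "\<Lambda> \<subseteq> \<Xi> \<Longrightarrow> \<zero> \<in> annihilator \<Lambda>"
  by (auto simp: annihilator_def)

lemma card_annihilator_pos: "\<Lambda> \<subseteq> \<Xi> \<Longrightarrow> card (annihilator \<Lambda>) > 0"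
  using annihilator_zero by (auto simp: card_gt_0_iff)

lemma annihilator_add:
  "\<lbrakk>\<Lambda> \<subseteq> \<Xi>; u \<in> annihilator \<Lambda>; v \<in> annihilator \<Lambda>\<rbrakk> \<Longrightarrow> u \<oplus> v \<in> annihilator \<Lambda>"
  by (auto simp: annihilator_def chi_add subset_iff)

lemma annihilator_minus:
  "\<lbrakk>\<Lambda> \<subseteq> \<Xi>; u \<in> annihilator \<Lambda>\<rbrakk> \<Longrightarrow> \<ominus> u \<in> annihilator \<Lambda>"
  by (auto simp: annihilator_def chi_minus subset_iff)

lemma bij_betw_annihilator_shift:
  assumes "\<Lambda> \<subseteq> \<Xi>" "u \<in> annihilator \<Lambda>"
  shows "bij_betw (\<lambda>v. v \<oplus> u) (annihilator \<Lambda>) (annihilator \<Lambda>)"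
proof (rule bij_betw_byWitness[where f' = "\<lambda>v. v \<oplus> \<ominus> u"])
  have "u \<in> carrier G"
    using assms annihilator_subset by blast
  moreover have "v \<in> carrier G" if "v \<in> annihilator \<Lambda>" for v
    using that annihilator_subset by blast
  ultimately show "\<forall>v\<in>annihilator \<Lambda>. v \<oplus> u \<oplus> \<ominus> u = v" "\<forall>v\<in>annihilator \<Lambda>. v \<oplus> \<ominus> u \<oplus> u = v"
    by (auto simp: a_assoc r_neg l_neg)
qed (use assms annihilator_add annihilator_minus in auto)

text \<open>Translation by \<open>u\<close> permutes the annihilator and multiplies the sum by
  \<open>\<chi> \<xi> u \<noteq> 1\<close>.\<close>

lemma sum_chi_annihilator:
  assumes \<Lambda>: "\<Lambda> \<subseteq> \<Xi>" and \<xi>: "\<xi> \<in> \<Xi>" and u: "u \<in> annihilator \<Lambda>" "\<chi> \<xi> u \<noteq> 1"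
  shows "(\<Sum>v\<in>annihilator \<Lambda>. \<chi> \<xi> v) = 0"
proof -
  have "(\<Sum>v\<in>annihilator \<Lambda>. \<chi> \<xi> v) = (\<Sum>v\<in>annihilator \<Lambda>. \<chi> \<xi> (v \<oplus> u))"
    using sum.reindex_bij_betw[OF bij_betw_annihilator_shift[OF \<Lambda> u(1)], of "\<chi> \<xi>"] by simp
  also have "\<dots> = (\<Sum>v\<in>annihilator \<Lambda>. \<chi> \<xi> v) * \<chi> \<xi> u"
    using u annihilator_subset[of \<Lambda>] \<xi>
    by (simp add: sum_distrib_right chi_add subset_iff)
  finally show ?thesis
    using u(2) by (simp add: algebra_simps)
qed

text \<open>On the Fourier side two averages over \<open>A\<close> supply the squares needed for
  Parseval, and \<open>l\<close> averages over \<open>X\<close> supply the decay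
  \<open>(1 / 2) ^ l\<close> off the large spectrum.\<close>

lemma sum_annihilator_iterate_close:
  fixes f W :: "'a \<Rightarrow> real" and l :: nat
  assumes A: "A \<subseteq> carrier G" "A \<noteq> {}" and X: "X \<subseteq> carrier G" "X \<noteq> {}" and \<Lambda>: "\<Lambda> \<subseteq> \<Xi>"
    and f: "\<And>x. x \<in> carrier G \<Longrightarrow> \<bar>f x\<bar> \<le> 1"
    and spec: "\<And>\<xi> v. \<lbrakk>\<xi> \<in> \<Xi>; norm (hat X \<xi>) \<ge> card X / 2; v \<in> annihilator \<Lambda>\<rbrakk> \<Longrightarrow> \<chi> \<xi> v = 1"
  defines "W \<equiv> (mean_shift X ^^ l) (mean_shift A (mean_shift A f))"
  shows "\<bar>(\<Sum>v\<in>annihilator \<Lambda>. W v) - card (annihilator \<Lambda>) * W \<zero>\<bar>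
    \<le> card (annihilator \<Lambda>) * ((1 / 2) ^ l * (card (carrier G) / card A))"
proof -
  let ?V = "annihilator \<Lambda>" and ?N = "card (carrier G)"
  have cA: "card A > 0" and cX: "card X > 0"
    using card_subset_carrier_pos A X by auto
  define c where "c \<xi> = (\<Sum>s\<in>carrier G. f s * \<chi> \<xi> (\<ominus> s)) / ?N" for \<xi>
  define d where "d l \<xi> = c \<xi> * (hat A \<xi> / card A) * (hat A \<xi> / card A) * (hat X \<xi> / card X) ^ l" for l \<xi>
  have c_le: "norm (c \<xi>) \<le> 1" if "\<xi> \<in> \<Xi>" for \<xi>
  proof -
    have "norm (\<Sum>s\<in>carrier G. f s * \<chi> \<xi> (\<ominus> s)) \<le> (\<Sum>s\<in>carrier G. norm (f s * \<chi> \<xi> (\<ominus> s)))"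
      by (rule norm_sum)
    also have "\<dots> \<le> (\<Sum>s\<in>carrier G. 1)"
      using f that by (intro sum_mono) (auto simp: norm_mult)
    finally show ?thesis
      using card_carrier_pos by (simp add: c_def norm_divide)
  qed
  have H: "complex_of_real (mean_shift A (mean_shift A f) x) = (\<Sum>\<xi>\<in>\<Xi>. d 0 \<xi> * \<chi> \<xi> x)"
    if "x \<in> carrier G" for x
  proof -
    have "complex_of_real (f x) = (\<Sum>\<xi>\<in>\<Xi>. c \<xi> * \<chi> \<xi> x)" if "x \<in> carrier G" for x
      unfolding c_def by (rule fourier_inversion[OF that])
    from mean_shift_fourier[OF A(1) that mean_shift_fourier[OF A(1) _ this]]
    show ?thesis
      by (simp add: d_def)
  qed
  have W_fourier: "complex_of_real ((mean_shift X ^^ l) (mean_shift A (mean_shift A f)) x) =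
      (\<Sum>\<xi>\<in>\<Xi>. d l \<xi> * \<chi> \<xi> x)" if "x \<in> carrier G" for x l
    using that
  proof (induction l arbitrary: x)
    case 0
    then show ?case
      by (simp add: H)
  next
    case (Suc l)
    show ?case
      using mean_shift_fourier[OF X(1) Suc.prems Suc.IH] by (simp add: d_def mult_ac)
  qed
  \<comment> \<open>A character trivial on \<open>?V\<close> contributes equally to both compared
    quantities. Any other one sums to zero over \<open>?V\<close> and, by \<open>spec\<close>, lies
    outside the large spectrum of \<open>X\<close>.\<close>
  have term_le: "norm (d l \<xi> * ((\<Sum>v\<in>?V. \<chi> \<xi> v) - card ?V)) \<le>
      card ?V * ((1 / 2) ^ l * ((norm (hat A \<xi>))\<^sup>2 / (card A)\<^sup>2))" if \<xi>: "\<xi> \<in> \<Xi>" for \<xi>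
  proof (cases "\<exists>u\<in>?V. \<chi> \<xi> u \<noteq> 1")
    case False
    then show ?thesis
      by simp
  next
    case True
    then have "norm (hat X \<xi>) / card X \<le> 1 / 2"
      using spec[OF \<xi>] cX by (force simp: field_simps)
    then have "(norm (hat X \<xi>) / card X) ^ l \<le> (1 / 2) ^ l"
      by (intro power_mono) auto
    then have "norm (c \<xi>) * ((norm (hat X \<xi>) / card X) ^ l * ((norm (hat A \<xi>))\<^sup>2 / (card A)\<^sup>2)) \<le>
        1 * ((1 / 2) ^ l * ((norm (hat A \<xi>))\<^sup>2 / (card A)\<^sup>2))"
      using c_le[OF \<xi>] by (intro mult_mono mult_right_mono) auto
    moreover have "norm (d l \<xi>) =
        norm (c \<xi>) * ((norm (hat X \<xi>) / card X) ^ l * ((norm (hat A \<xi>))\<^sup>2 / (card A)\<^sup>2))"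
      by (simp add: d_def norm_mult norm_divide norm_power power2_eq_square)
    ultimately have "norm (d l \<xi>) \<le> (1 / 2) ^ l * ((norm (hat A \<xi>))\<^sup>2 / (card A)\<^sup>2)"
      by simp
    then have "card ?V * norm (d l \<xi>) \<le> card ?V * ((1 / 2) ^ l * ((norm (hat A \<xi>))\<^sup>2 / (card A)\<^sup>2))"
      by (intro mult_left_mono) auto
    moreover have "(\<Sum>v\<in>?V. \<chi> \<xi> v) = 0"
      using True sum_chi_annihilator[OF \<Lambda> \<xi>] by blast
    ultimately show ?thesis
      by (simp add: norm_mult mult_ac)
  qed
  have "complex_of_real ((\<Sum>v\<in>?V. W v) - card ?V * W \<zero>) =
      (\<Sum>v\<in>?V. complex_of_real (W v)) - card ?V * complex_of_real (W \<zero>)"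
    by simp
  also have "\<dots> = (\<Sum>v\<in>?V. \<Sum>\<xi>\<in>\<Xi>. d l \<xi> * \<chi> \<xi> v) - card ?V * (\<Sum>\<xi>\<in>\<Xi>. d l \<xi> * \<chi> \<xi> \<zero>)"
    using annihilator_subset[of \<Lambda>] unfolding W_def
    by (intro arg_cong2[of _ _ _ _ "(-)"] arg_cong2[of _ _ _ _ "(*)"] sum.cong refl W_fourier) auto
  also have "\<dots> = (\<Sum>\<xi>\<in>\<Xi>. d l \<xi> * ((\<Sum>v\<in>?V. \<chi> \<xi> v) - card ?V))"
    by (subst sum.swap) (simp add: sum_distrib_left sum_distrib_right sum_subtractf right_diff_distrib mult_ac)
  finally have "\<bar>(\<Sum>v\<in>?V. W v) - card ?V * W \<zero>\<bar> =
      norm (\<Sum>\<xi>\<in>\<Xi>. d l \<xi> * ((\<Sum>v\<in>?V. \<chi> \<xi> v) - card ?V))"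
    by (metis norm_of_real real_norm_def)
  also have "\<dots> \<le> (\<Sum>\<xi>\<in>\<Xi>. card ?V * ((1 / 2) ^ l * ((norm (hat A \<xi>))\<^sup>2 / (card A)\<^sup>2)))"
    by (intro order.trans[OF norm_sum] sum_mono term_le)
  also have "\<dots> = card ?V * ((1 / 2) ^ l * ((\<Sum>\<xi>\<in>\<Xi>. (norm (hat A \<xi>))\<^sup>2) / (card A)\<^sup>2))"
    by (simp only: sum_distrib_left sum_divide_distrib)
  also have "\<dots> = card ?V * ((1 / 2) ^ l * (card (carrier G) / card A))"
    unfolding parseval[OF A(1)] using cA by (simp add: power2_eq_square)
  finally show ?thesis .
qed

text \<open>If every coset sum of \<open>f\<close> were at most half of
  \<open>card (annihilator \<Lambda>)\<close>, the same would hold for every iterated average. But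
  the iterate is at least \<open>3/4\<close> at zero and its mean over the annihilator differs from
  that value by at most \<open>1/8\<close>.\<close>

lemma ex_dense_coset:
  fixes f :: "'a \<Rightarrow> real" and \<delta> :: real
  assumes A: "A \<subseteq> carrier G" "A \<noteq> {}" and X: "X \<subseteq> carrier G" "X \<noteq> {}" and \<Lambda>: "\<Lambda> \<subseteq> \<Xi>"
    and f: "\<And>x. x \<in> carrier G \<Longrightarrow> \<bar>f x\<bar> \<le> 1"
    and spec: "\<And>\<xi> v. \<lbrakk>\<xi> \<in> \<Xi>; norm (hat X \<xi>) \<ge> card X / 2; v \<in> annihilator \<Lambda>\<rbrakk> \<Longrightarrow> \<chi> \<xi> v = 1"
    and close: "\<And>x h. x \<in> X \<Longrightarrow> h \<in> carrier G \<Longrightarrow>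
      \<bar>mean_shift A (mean_shift A f) (h \<oplus> x) - mean_shift A (mean_shift A f) h\<bar> \<le> \<delta>"
    and one: "mean_shift A (mean_shift A f) \<zero> = 1"
    and l: "l * \<delta> \<le> 1 / 4" "8 * card (carrier G) \<le> 2 ^ l * card A"
  shows "\<exists>x\<in>carrier G. card (annihilator \<Lambda>) < 2 * (\<Sum>v\<in>annihilator \<Lambda>. f (x \<oplus> v))"
proof (rule ccontr)
  let ?V = "annihilator \<Lambda>"
  assume "\<not> ?thesis"
  then have f_le: "(\<Sum>v\<in>?V. f (x \<oplus> v)) \<le> card ?V / 2" if "x \<in> carrier G" for x
    using that by (auto simp: not_less)
  define W :: "nat \<Rightarrow> 'a \<Rightarrow> real" where "W l = (mean_shift X ^^ l) (mean_shift A (mean_shift A f))" for l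
  have W_le: "(\<Sum>v\<in>?V. W l (x \<oplus> v)) \<le> card ?V / 2" if "x \<in> carrier G" for x l
    using that
  proof (induction l arbitrary: x)
    case 0
    have "(\<Sum>v\<in>?V. mean_shift A f (x \<oplus> v)) \<le> card ?V / 2" if "x \<in> carrier G" for x
      by (rule sum_mean_shift_le[OF A annihilator_subset that f_le])
    from sum_mean_shift_le[OF A annihilator_subset 0 this] show ?case
      by (simp add: W_def)
  next
    case (Suc l)
    from sum_mean_shift_le[OF X annihilator_subset Suc.prems Suc.IH] show ?case
      by (simp add: W_def)
  qed
  have "(\<Sum>v\<in>?V. W l (\<zero> \<oplus> v)) = (\<Sum>v\<in>?V. W l v)"
    using annihilator_subset[of \<Lambda>] by (intro sum.cong) auto
  then have upper: "(\<Sum>v\<in>?V. W l v) \<le> card ?V / 2"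
    using W_le[of \<zero> l] by simp
  have "\<bar>W l \<zero> - 1\<bar> \<le> l * \<delta>"
    using mean_shift_iterate_close[OF X close, of \<zero> l] one by (simp add: W_def)
  then have "3 / 4 \<le> W l \<zero>"
    using l(1) by linarith
  then have lower: "card ?V * (3 / 4) \<le> card ?V * W l \<zero>"
    by (intro mult_left_mono) auto
  have "real (8 * card (carrier G)) \<le> real (2 ^ l * card A)"
    using l(2) by (simp only: of_nat_le_iff)
  then have "(1 / 2) ^ l * (card (carrier G) / card A) \<le> 1 / 8"
    using card_subset_carrier_pos[OF A] by (simp add: field_simps)
  then have "card ?V * ((1 / 2) ^ l * (card (carrier G) / card A)) \<le> card ?V * (1 / 8)"
    by (intro mult_left_mono) auto
  moreover have "\<bar>(\<Sum>v\<in>?V. W l v) - card ?V * W l \<zero>\<bar>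
      \<le> card ?V * ((1 / 2) ^ l * (card (carrier G) / card A))"
    unfolding W_def by (rule sum_annihilator_iterate_close[OF A X \<Lambda> f spec])
  moreover have "real (card ?V) > 0"
    using card_annihilator_pos[OF \<Lambda>] by simp
  ultimately show False
    using upper lower by linarith
qed

subsection \<open>The large spectrum\<close>

text \<open>
  A substitute for linearly independent families of characters: each new character is nontrivial
  on the common kernel of the earlier ones. This suffices for the values to behave independently.
\<close>

primrec triangular :: "'x list \<Rightarrow> bool" where
  "triangular [] \<longleftrightarrow> True"
| "triangular (\<xi> # \<Lambda>) \<longleftrightarrow> \<xi> \<in> \<Xi> \<and> (\<exists>v\<in>annihilator (set \<Lambda>). \<chi> \<xi> v \<noteq> 1) \<and> triangular \<Lambda>"

lemma triangular_subset: "triangular \<Lambda> \<Longrightarrow> set \<Lambda> \<subseteq> \<Xi>"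
  by (induction \<Lambda>) auto

text \<open>Characters are peeled off from the head: a shift by \<open>v\<close> fixes all later
  characters but rotates \<xi>, so \<xi> contributes a separate factor by Hoeffding's lemma.\<close>

lemma triangular_exp_moment:
  assumes "triangular \<Lambda>" and c: "\<And>\<xi>. norm (c \<xi>) \<le> 1"
  shows "(\<Sum>x\<in>carrier G. exp (s * (\<Sum>\<xi>\<leftarrow>\<Lambda>. Re (c \<xi> * \<chi> \<xi> x)))) \<le>
    card (carrier G) * exp (s\<^sup>2 / 2) ^ length \<Lambda>"
  using \<open>triangular \<Lambda>\<close>
proof (induction \<Lambda>)
  case (Cons \<xi> \<Lambda>)
  then obtain v where \<xi>: "\<xi> \<in> \<Xi>" and v: "v \<in> carrier G" "\<chi> \<xi> v \<noteq> 1"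
    "\<And>\<mu>. \<mu> \<in> set \<Lambda> \<Longrightarrow> \<chi> \<mu> v = 1" and tri: "triangular \<Lambda>"
    by (auto simp: annihilator_def)
  define Q where "Q x = exp (s * (\<Sum>\<mu>\<leftarrow>\<Lambda>. Re (c \<mu> * \<chi> \<mu> x)))" for x
  define e where "e z = exp (s * Re (c \<xi> * z))" for z
  have Q_shift: "Q (x \<oplus> v) = Q x" if "x \<in> carrier G" for x
  proof -
    have "\<chi> \<mu> (x \<oplus> v) = \<chi> \<mu> x" if "\<mu> \<in> set \<Lambda>" for \<mu>
      using that triangular_subset[OF tri] v \<open>x \<in> carrier G\<close> by (auto simp: chi_add subset_iff)
    then show ?thesis
      unfolding Q_def by (metis (mono_tags, lifting) map_eq_conv)
  qed
  have rotate: "(\<Sum>x\<in>carrier G. Q x * e (\<chi> \<xi> x)) =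
      (\<Sum>x\<in>carrier G. Q x * e (\<chi> \<xi> x * \<chi> \<xi> v ^ u))" for u
  proof (induction u)
    case (Suc u)
    have "(\<Sum>x\<in>carrier G. Q x * e (\<chi> \<xi> x)) =
        (\<Sum>x\<in>carrier G. Q (x \<oplus> v) * e (\<chi> \<xi> (x \<oplus> v) * \<chi> \<xi> v ^ u))"
      using Suc sum_carrier_shift[OF v(1), of "\<lambda>x. Q x * e (\<chi> \<xi> x * \<chi> \<xi> v ^ u)"] by simp
    also have "\<dots> = (\<Sum>x\<in>carrier G. Q x * e (\<chi> \<xi> x * \<chi> \<xi> v ^ Suc u))"
      using \<xi> v by (intro sum.cong refl) (simp add: Q_shift chi_add mult_ac)
    finally show ?case .
  qed simp
  \<comment> \<open>Averaging \<open>rotate\<close> over \<open>u < q\<close> replaces the value at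
    \<xi> by powers of a nontrivial root of unity, whose sum is zero.\<close>
  have "q * (\<Sum>x\<in>carrier G. Q x * e (\<chi> \<xi> x)) =
      (\<Sum>u<q. \<Sum>x\<in>carrier G. Q x * e (\<chi> \<xi> x * \<chi> \<xi> v ^ u))"
    by (simp flip: rotate)
  also have "\<dots> = (\<Sum>x\<in>carrier G. Q x * (\<Sum>u<q. e (\<chi> \<xi> x * \<chi> \<xi> v ^ u)))"
    by (subst sum.swap) (simp add: sum_distrib_left)
  also have "\<dots> \<le> (\<Sum>x\<in>carrier G. Q x * (q * exp (s\<^sup>2 / 2)))"
  proof (intro sum_mono mult_left_mono)
    fix x assume x: "x \<in> carrier G"
    have "(\<Sum>u<q. e (\<chi> \<xi> x * \<chi> \<xi> v ^ u)) \<le> card {..<q} * exp (s\<^sup>2 / 2)"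
      unfolding e_def
    proof (rule sum_exp_mean_zero_le)
      show "(\<Sum>u<q. Re (c \<xi> * (\<chi> \<xi> x * \<chi> \<xi> v ^ u))) = 0"
        using sum_roots_unity_powers[OF chi_power[OF \<xi> v(1)] v(2)]
        by (simp only: Re_sum[symmetric] sum_distrib_left[symmetric]) simp
      fix u
      have "\<bar>Re (c \<xi> * (\<chi> \<xi> x * \<chi> \<xi> v ^ u))\<bar> \<le> norm (c \<xi> * (\<chi> \<xi> x * \<chi> \<xi> v ^ u))"
        by (rule abs_Re_le_cmod)
      also have "\<dots> \<le> 1"
        using c \<xi> x v by (simp add: norm_mult norm_power)
      finally show "\<bar>Re (c \<xi> * (\<chi> \<xi> x * \<chi> \<xi> v ^ u))\<bar> \<le> 1" .
    qed
    then show "(\<Sum>u<q. e (\<chi> \<xi> x * \<chi> \<xi> v ^ u)) \<le> q * exp (s\<^sup>2 / 2)"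
      by simp
  qed (simp add: Q_def)
  also have "\<dots> = q * (exp (s\<^sup>2 / 2) * (\<Sum>x\<in>carrier G. Q x))"
    by (simp add: sum_distrib_left sum_distrib_right mult_ac)
  also have "\<dots> \<le> q * (exp (s\<^sup>2 / 2) * (card (carrier G) * exp (s\<^sup>2 / 2) ^ length \<Lambda>))"
    unfolding Q_def by (intro mult_left_mono Cons.IH tri) auto
  finally have "(\<Sum>x\<in>carrier G. Q x * e (\<chi> \<xi> x)) \<le>
      exp (s\<^sup>2 / 2) * (card (carrier G) * exp (s\<^sup>2 / 2) ^ length \<Lambda>)"
    using q_pos by simp
  then show ?case
    by (simp add: Q_def e_def distrib_left exp_add mult_ac)
qed simp

text \<open>Chang's bound: the exponential moment at \<open>s = 1/2\<close>, with \<open>c \<xi>\<close> aligning the phases.\<close>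

lemma triangular_spectrum_bound:
  assumes X: "X \<subseteq> carrier G" and tri: "triangular \<Lambda>"
    and spec: "\<And>\<xi>. \<xi> \<in> set \<Lambda> \<Longrightarrow> norm (hat X \<xi>) \<ge> card X / 2"
  shows "card X * exp (length \<Lambda> / 8) \<le> card (carrier G)"
proof -
  define c where "c \<xi> = cnj (sgn (hat X \<xi>))" for \<xi>
  have c: "norm (c \<xi>) \<le> 1" and align: "Re (c \<xi> * hat X \<xi>) = norm (hat X \<xi>)" for \<xi>
  proof -
    show "norm (c \<xi>) \<le> 1"
      by (simp add: c_def norm_sgn)
    have "c \<xi> * hat X \<xi> = (hat X \<xi> * cnj (hat X \<xi>)) / norm (hat X \<xi>)"
      by (simp add: c_def sgn_eq mult_ac)
    also have "\<dots> = norm (hat X \<xi>)"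
      by (simp add: power2_eq_square flip: complex_norm_square)
    finally show "Re (c \<xi> * hat X \<xi>) = norm (hat X \<xi>)"
      by simp
  qed
  define y where "y x = 1 / 2 * (\<Sum>\<xi>\<leftarrow>\<Lambda>. Re (c \<xi> * \<chi> \<xi> x))" for x
  \<comment> \<open>A lower bound for the mean of \<open>y\<close> over \<open>X\<close>: each
    character gives \<open>1/2\<close> by \<open>spec\<close>, times the factor \<open>1/2\<close>
    in \<open>y\<close>.\<close>
  define b where "b = length \<Lambda> / 4"
  have "(\<Sum>x\<in>X. \<Sum>\<xi>\<leftarrow>L. Re (c \<xi> * \<chi> \<xi> x)) \<ge> length L * (card X / 2)"
    if "set L \<subseteq> set \<Lambda>" for L
    using that
  proof (induction L)
    case (Cons \<xi> L)
    have "(\<Sum>x\<in>X. Re (c \<xi> * \<chi> \<xi> x)) = Re (c \<xi> * hat X \<xi>)"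
      by (simp only: hat_def sum_distrib_left Re_sum)
    also have "\<dots> \<ge> card X / 2"
      unfolding align using spec Cons.prems by simp
    finally have "card X / 2 + length L * (card X / 2) \<le>
        (\<Sum>x\<in>X. Re (c \<xi> * \<chi> \<xi> x)) + (\<Sum>x\<in>X. \<Sum>\<xi>\<leftarrow>L. Re (c \<xi> * \<chi> \<xi> x))"
      using Cons by (intro add_mono) auto
    then show ?case
      by (simp add: sum.distrib distrib_right del: times_complex.sel)
  qed simp
  from this[of \<Lambda>] have sum_y: "(\<Sum>x\<in>X. y x) \<ge> card X * b"
    by (simp add: y_def b_def mult.commute flip: sum_divide_distrib del: times_complex.sel)
  \<comment> \<open>Jensen through the tangent to \<open>exp\<close> at \<open>b\<close>.\<close>
  have "card X * exp b \<le> exp b * (card X + ((\<Sum>x\<in>X. y x) - card X * b))"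
    using sum_y by (simp add: algebra_simps)
  also have "\<dots> = (\<Sum>x\<in>X. exp b * (1 + (y x - b)))"
    by (simp add: sum_distrib_left[symmetric] sum.distrib sum_subtractf)
  also have "\<dots> \<le> (\<Sum>x\<in>X. exp b * exp (y x - b))"
    by (intro sum_mono mult_left_mono exp_ge_add_one_self) auto
  also have "\<dots> = (\<Sum>x\<in>X. exp (y x))"
    by (simp flip: exp_add)
  also have "\<dots> \<le> (\<Sum>x\<in>carrier G. exp (y x))"
    using X by (intro sum_mono2) auto
  also have "\<dots> \<le> card (carrier G) * exp ((1 / 2)\<^sup>2 / 2) ^ length \<Lambda>"
    unfolding y_def by (intro triangular_exp_moment tri c)
  also have "exp ((1 / 2)\<^sup>2 / 2) ^ length \<Lambda> = exp (length \<Lambda> / 8)"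
    by (simp add: power2_eq_square flip: exp_of_nat_mult)
  finally have "card X * exp b \<le> card (carrier G) * exp (length \<Lambda> / 8)" .
  \<comment> \<open>The exponent \<open>b\<close> is twice \<open>length \<Lambda> / 8\<close>, so
    one factor cancels and one remains.\<close>
  moreover have "exp b = exp (length \<Lambda> / 8) * exp (length \<Lambda> / 8)"
    by (simp add: b_def flip: exp_add)
  ultimately have "card X * exp (length \<Lambda> / 8) * exp (length \<Lambda> / 8) \<le>
      card (carrier G) * exp (length \<Lambda> / 8)"
    by (simp only: mult.assoc)
  then show ?thesis
    by (rule mult_right_le_imp_le) simp
qed

text \<open>A longest triangular list inside the large spectrum: a character of the spectrum
  nontrivial on its annihilator could be prepended.\<close>

lemma ex_maximal_triangular_spectrum:
  assumes X: "X \<subseteq> carrier G" "X \<noteq> {}"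
  obtains \<Lambda> where "set \<Lambda> \<subseteq> \<Xi>" "card X * exp (length \<Lambda> / 8) \<le> card (carrier G)"
    "\<And>\<xi> v. \<lbrakk>\<xi> \<in> \<Xi>; norm (hat X \<xi>) \<ge> card X / 2; v \<in> annihilator (set \<Lambda>)\<rbrakk> \<Longrightarrow> \<chi> \<xi> v = 1"
proof -
  let ?P = "\<lambda>\<Lambda>. triangular \<Lambda> \<and> (\<forall>\<xi>\<in>set \<Lambda>. norm (hat X \<xi>) \<ge> card X / 2)"
  have cX: "card X > 0"
    by (rule card_subset_carrier_pos[OF X])
  have bound: "card X * exp (length \<Lambda> / 8) \<le> card (carrier G)" if "?P \<Lambda>" for \<Lambda>
    using that by (intro triangular_spectrum_bound X) auto
  \<comment> \<open>A crude bound which guarantees that a longest list exists.\<close>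
  have "length \<Lambda> < 8 * card (carrier G)" if "?P \<Lambda>" for \<Lambda>
  proof -
    have "length \<Lambda> / 8 < exp (length \<Lambda> / 8)"
      using exp_ge_add_one_self[of "length \<Lambda> / 8"] by linarith
    also have "\<dots> \<le> card X * exp (length \<Lambda> / 8)"
      using cX by simp
    also have "\<dots> \<le> card (carrier G)"
      by (rule bound[OF that])
    finally show ?thesis
      by simp
  qed
  then obtain \<Lambda> where \<Lambda>: "?P \<Lambda>" and max: "\<And>\<Lambda>'. ?P \<Lambda>' \<Longrightarrow> length \<Lambda>' \<le> length \<Lambda>"
    using ex_has_greatest_nat[of ?P "[]" length "8 * card (carrier G)"] by auto
  show thesis
  proof (rule that)
    show "set \<Lambda> \<subseteq> \<Xi>" "card X * exp (length \<Lambda> / 8) \<le> card (carrier G)"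
      using \<Lambda> triangular_subset bound by auto
    fix \<xi> v assume "\<xi> \<in> \<Xi>" "norm (hat X \<xi>) \<ge> card X / 2" "v \<in> annihilator (set \<Lambda>)"
    then show "\<chi> \<xi> v = 1"
      using max[of "\<xi> # \<Lambda>"] \<Lambda> by auto
  qed
qed

text \<open>Each further character takes at most \<open>q\<close> values on the previous
  annihilator, so it shrinks it by a factor of at most \<open>q\<close>.\<close>

lemma card_annihilator_ge:
  assumes "set \<Lambda> \<subseteq> \<Xi>"
  shows "card (carrier G) \<le> q ^ length \<Lambda> * card (annihilator (set \<Lambda>))"
  using assms
proof (induction \<Lambda>)
  case Nil
  then show ?case
    by (simp add: annihilator_def)
next
  case (Cons \<xi> \<Lambda>)
  let ?V = "annihilator (set \<Lambda>)" and ?V' = "annihilator (set (\<xi> # \<Lambda>))"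
  let ?R = "{z::complex. z ^ q = 1}"
  let ?F = "\<lambda>z. {v \<in> ?V. \<chi> \<xi> v = z}"
  have \<xi>: "\<xi> \<in> \<Xi>" "set \<Lambda> \<subseteq> \<Xi>"
    using Cons.prems by auto
  \<comment> \<open>Subtracting one element of a nonempty fibre maps the fibre injectively into the
    kernel.\<close>
  have fiber: "card (?F z) \<le> card ?V'" for z
  proof (cases "?F z = {}")
    case False
    then obtain w where w: "w \<in> ?V" "\<chi> \<xi> w = z"
      by blast
    have "(\<lambda>v. v \<oplus> \<ominus> w) ` ?F z \<subseteq> ?V'"
    proof (rule image_subsetI)
      fix v assume v: "v \<in> ?F z"
      then have vw: "v \<oplus> \<ominus> w \<in> ?V"
        using w \<xi> by (auto intro!: annihilator_add annihilator_minus)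
      have "v \<in> carrier G" "w \<in> carrier G"
        using v w annihilator_subset by blast+
      then have "\<chi> \<xi> (v \<oplus> \<ominus> w) = \<chi> \<xi> (w \<oplus> \<ominus> w)"
        using v w \<xi> by (simp add: chi_add del: r_neg)
      also have "\<dots> = 1"
        using \<xi> \<open>w \<in> carrier G\<close> by (simp add: r_neg)
      finally show "v \<oplus> \<ominus> w \<in> ?V'"
        using vw by (auto simp: annihilator_def)
    qed
    moreover have "inj_on (\<lambda>v. v \<oplus> \<ominus> w) (?F z)"
      using w annihilator_subset[of "set \<Lambda>"] by (intro inj_onI) (auto simp: subset_iff)
    ultimately show ?thesis
      by (intro card_inj_on_le[of "\<lambda>v. v \<oplus> \<ominus> w"]) auto
  qed (simp only: card.empty)
  have finR: "finite ?R"
    using q_pos by (intro finite_roots_unity) auto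
  have "?V \<subseteq> (\<Union>z\<in>?R. ?F z)"
    using annihilator_subset \<xi> by (auto intro: chi_power)
  then have "card ?V \<le> card (\<Union>z\<in>?R. ?F z)"
    using finR by (intro card_mono) auto
  also have "\<dots> \<le> (\<Sum>z\<in>?R. card (?F z))"
    by (rule card_UN_le[OF finR])
  also have "\<dots> \<le> card ?R * card ?V'"
    using fiber sum_bounded_above[of ?R "\<lambda>z. card (?F z)" "card ?V'"] by simp
  also have "card ?R = q"
    using q_pos by (intro card_roots_unity_eq) auto
  finally have "card ?V \<le> q * card ?V'" .
  then have "q ^ length \<Lambda> * card ?V \<le> q ^ length \<Lambda> * (q * card ?V')"
    by (rule mult_left_mono) simp
  with Cons.IH[OF \<xi>(2)] have "card (carrier G) \<le> q ^ length \<Lambda> * (q * card ?V')"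
    by (rule order.trans)
  then show ?case
    by (simp add: mult_ac)
qed

text \<open>Pigeonhole: the trace of \<open>S\<close> on the coset and its shift by \<open>u\<close>
  each fill more than half of the annihilator, so they meet.\<close>

lemma annihilator_subset_difference:
  assumes \<Lambda>: "\<Lambda> \<subseteq> \<Xi>" and x: "x \<in> carrier G"
    and dense: "card (annihilator \<Lambda>) < 2 * card {v \<in> annihilator \<Lambda>. x \<oplus> v \<in> S}"
  shows "annihilator \<Lambda> \<subseteq> diff_set G S"
proof
  fix u assume u: "u \<in> annihilator \<Lambda>"
  let ?V = "annihilator \<Lambda>"
  let ?B = "{v \<in> ?V. x \<oplus> v \<in> S}"
  let ?B' = "(\<lambda>v. v \<oplus> u) ` ?B"
  have bij: "bij_betw (\<lambda>v. v \<oplus> u) ?V ?V"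
    by (rule bij_betw_annihilator_shift[OF \<Lambda> u])
  have "card ?B' = card ?B"
    using bij by (intro card_image) (auto simp: bij_betw_def intro: inj_on_subset)
  moreover have "?B \<union> ?B' \<subseteq> ?V"
    using \<Lambda> u annihilator_add by auto
  then have "card (?B \<union> ?B') \<le> card ?V"
    by (intro card_mono) auto
  ultimately have "?B \<inter> ?B' \<noteq> {}"
    using dense card_Un_disjoint[of ?B ?B'] by force
  then obtain v where v: "v \<in> ?V" "x \<oplus> v \<in> S" "x \<oplus> (v \<oplus> u) \<in> S"
    by auto
  have "u \<in> carrier G" "v \<in> carrier G"
    using u v annihilator_subset by blast+
  then have "u = (x \<oplus> (v \<oplus> u)) \<ominus> (x \<oplus> v)"
    using x by (simp add: a_minus_def minus_add a_ac r_neg r_neg2)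
  then show "u \<in> diff_set G S"
    using v unfolding diff_set_def by blast
qed

subsection \<open>Subspaces of iterated difference sets\<close>

text \<open>In the application \<open>L\<close> is \<open>ln (K * p)\<close>. The constant is
  \<open>200 = 8 * 25\<close> times the coefficient of \<open>L ^ 3\<close> in the bound for the
  sample size \<open>k\<close>.\<close>

theorem bogolyubov_ruzsa:
  fixes L :: real
  assumes A: "A \<subseteq> carrier G" "A \<noteq> {}"
    and L: "ln 2 \<le> L" and density: "card (carrier G) \<le> exp (24 * L) * card A"
  obtains \<Lambda> where "set \<Lambda> \<subseteq> \<Xi>" "length \<Lambda> \<le> 200 * (2304 * 14 * 56\<^sup>2) * L ^ 4"
    "annihilator (set \<Lambda>) \<subseteq> double_diff_set G A"
proof -
  let ?N = "card (carrier G)"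
  have cA: "card A > 0"
    by (rule card_subset_carrier_pos[OF A])
  have ln2: "ln 2 \<ge> (1 / 2 :: real)"
    using ln_le_minus_one[of "1 / 2 :: real"] by (simp add: ln_div)
  then have "L \<ge> 1 / 2"
    using L by linarith
  \<comment> \<open>With \<open>ln 2 \<ge> 1 / 2\<close> and \<open>27 = 3 + 24\<close> this gives
    \<open>2 ^ l \<ge> 8 * exp (24 * L)\<close>.\<close>
  define l where "l = nat \<lceil>54 * L\<rceil>"
  \<comment> \<open>Gives \<open>exp (24 * L) \<le> exp (2 * m) \<le> 9 ^ m\<close>.\<close>
  define m where "m = nat \<lceil>12 * L\<rceil>"
  \<comment> \<open>Makes \<open>8 * m / k\<close> equal to \<open>\<delta>\<^sup>2 / 18\<close>; in
    \<open>18 = 2 * 9\<close> the 9 pays for the density and the 2 for the leading factor 2.\<close>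
  define k where "k = 2304 * m * l\<^sup>2"
  \<comment> \<open>The \<open>l\<close> averages over \<open>X\<close> then lose \<open>1/4\<close>
    in total.\<close>
  define \<delta> where "\<delta> = 1 / (4 * real l)"
  define S where "S = {a \<oplus> b | a b. a \<in> A \<and> b \<in> A}"
  define f where "f x = (of_bool (x \<in> S) :: real)" for x
  \<comment> \<open>Rounding up adds at most \<open>1 \<le> 2 * L\<close>.\<close>
  have l: "54 * L \<le> l" "l \<le> 56 * L" and m: "12 * L \<le> m" "m \<le> 14 * L"
    using \<open>L \<ge> 1 / 2\<close> by (auto simp: l_def m_def) linarith+
  then have "l \<ge> 1" "m \<ge> 1"
    using \<open>L \<ge> 1 / 2\<close> by linarith+
  then have "k \<ge> 1"
    by (simp add: k_def)
  have "L > 0"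
    using \<open>L \<ge> 1 / 2\<close> by simp

  have "2 * ?N * (8 * m / k) ^ m \<le> card A * \<delta> ^ (2 * m)"
  proof -
    have "8 * m / k = \<delta>\<^sup>2 / 18"
      using \<open>l \<ge> 1\<close> \<open>m \<ge> 1\<close> by (simp add: k_def \<delta>_def field_simps power2_eq_square)
    then have pow: "(8 * m / k) ^ m = \<delta> ^ (2 * m) / 18 ^ m"
      by (simp only: power_divide power_mult)
    have "exp (24 * L) \<le> exp (1 * real (2 * m))"
      using m(1) by simp
    also have "\<dots> = exp 1 ^ (2 * m)"
      by (simp only: exp_of_nat2_mult)
    also have "\<dots> \<le> 3 ^ (2 * m)"
      using exp_le by (intro power_mono) auto
    also have "\<dots> = (9::real) ^ m"
      by (simp add: power_mult)
    finally have "2 * exp (24 * L) \<le> 2 ^ m * 9 ^ m"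
      using \<open>m \<ge> 1\<close> self_le_power[of "2::real" m] by (intro mult_mono) auto
    also have "\<dots> = 18 ^ m"
      by (simp flip: power_mult_distrib)
    finally have "2 * exp (24 * L) * card A \<le> 18 ^ m * real (card A)"
      by (rule mult_right_mono) simp
    then have "2 * ?N \<le> 18 ^ m * real (card A)"
      using density by linarith
    then have "(2 * ?N) * (\<delta> ^ (2 * m) / 18 ^ m) \<le> (18 ^ m * real (card A)) * (\<delta> ^ (2 * m) / 18 ^ m)"
      by (intro mult_right_mono) (auto simp: \<delta>_def)
    then show ?thesis
      unfolding pow by simp
  qed
  moreover have "0 \<le> f x \<and> f x \<le> 1" for x
    by (simp add: f_def)
  ultimately obtain X where X: "X \<subseteq> carrier G"
    and cX: "real (card A) ^ k * ?N \<le> 2 * real ?N ^ k * card X"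
    and close: "\<And>x h. x \<in> X \<Longrightarrow> h \<in> carrier G \<Longrightarrow>
      \<bar>mean_shift A (mean_shift A f) (h \<oplus> x) - mean_shift A (mean_shift A f) h\<bar> \<le> \<delta>"
    using croot_sisask[OF A \<open>m \<ge> 1\<close> \<open>k \<ge> 1\<close>, of f \<delta>] by (auto simp: \<delta>_def)
  have large: "?N \<le> 2 * exp (24 * L * k) * card X"
  proof -
    have "real ?N ^ k \<le> (exp (24 * L) * card A) ^ k"
      using density by (intro power_mono) auto
    also have "\<dots> = exp (24 * L * k) * real (card A) ^ k"
      by (simp add: power_mult_distrib exp_of_nat2_mult)
    finally have "2 * real ?N ^ k * card X \<le> 2 * (exp (24 * L * k) * real (card A) ^ k) * card X"
      by (intro mult_right_mono mult_left_mono) auto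
    with cX have "real (card A) ^ k * ?N \<le> 2 * (exp (24 * L * k) * real (card A) ^ k) * card X"
      by (rule order.trans)
    then have "real (card A) ^ k * ?N \<le> real (card A) ^ k * (2 * exp (24 * L * k) * card X)"
      by (simp only: mult_ac)
    then show ?thesis
      using cA by (subst (asm) mult_le_cancel_left_pos) auto
  qed
  then have "X \<noteq> {}"
    using card_carrier_pos by auto
  obtain \<Lambda> where \<Lambda>: "set \<Lambda> \<subseteq> \<Xi>" "card X * exp (length \<Lambda> / 8) \<le> ?N"
    and spec: "\<And>\<xi> v. \<lbrakk>\<xi> \<in> \<Xi>; norm (hat X \<xi>) \<ge> card X / 2; v \<in> annihilator (set \<Lambda>)\<rbrakk>
      \<Longrightarrow> \<chi> \<xi> v = 1"
    using ex_maximal_triangular_spectrum[OF X \<open>X \<noteq> {}\<close>] by metis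

  \<comment> \<open>Chang's bound and the density of \<open>X\<close> give \<open>length \<Lambda> /
    8 \<le> ln 2 + 24 * L * k \<le> 25 * L * k\<close>, and \<open>k\<close> is of order
    \<open>L ^ 3\<close>.\<close>
  have len: "length \<Lambda> \<le> 200 * (2304 * 14 * 56\<^sup>2) * L ^ 4"
  proof -
    have "card X * exp (length \<Lambda> / 8) \<le> card X * (2 * exp (24 * L * k))"
      using \<Lambda>(2) large by (simp add: mult_ac)
    then have "exp (length \<Lambda> / 8) \<le> 2 * exp (24 * L * k)"
      using card_subset_carrier_pos[OF X \<open>X \<noteq> {}\<close>] by simp
    also have "\<dots> = exp (ln 2 + 24 * L * k)"
      by (simp add: exp_add)
    finally have "length \<Lambda> / 8 \<le> ln 2 + 24 * L * k"
      by simp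
    also have "\<dots> \<le> L * k + 24 * L * k"
    proof -
      have "L * 1 \<le> L * k"
        using \<open>L > 0\<close> \<open>k \<ge> 1\<close> by (intro mult_left_mono) auto
      then show ?thesis
        using L by simp
    qed
    finally have "length \<Lambda> \<le> 200 * L * k"
      by simp
    also have "real k \<le> 2304 * (14 * L) * (56 * L)\<^sup>2"
      unfolding k_def of_nat_mult of_nat_power using l m \<open>L > 0\<close>
      by (intro mult_mono power_mono) auto
    then have "200 * L * k \<le> 200 * L * (2304 * (14 * L) * (56 * L)\<^sup>2)"
      using \<open>L > 0\<close> by (intro mult_left_mono) auto
    also have "\<dots> = 200 * (2304 * 14 * 56\<^sup>2) * L ^ 4"
      by (simp add: power_mult_distrib power2_eq_square power4_eq_xxxx)
    finally show ?thesis .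
  qed

  \<comment> \<open>Every sum of two elements of \<open>A\<close> lies in \<open>S\<close>, so the
    double average equals one at zero.\<close>
  have "mean_shift A f a = 1" if "a \<in> A" for a
  proof -
    have "f (a \<oplus> b) = 1" if "b \<in> A" for b
      using \<open>a \<in> A\<close> that by (auto simp: f_def S_def)
    then show ?thesis
      using cA by (simp add: mean_shift_def)
  qed
  then have "(\<Sum>a\<in>A. mean_shift A f (\<zero> \<oplus> a)) = (\<Sum>a\<in>A. 1)"
    using A by (intro sum.cong) auto
  then have one: "mean_shift A (mean_shift A f) \<zero> = 1"
    using cA by (simp add: mean_shift_def[of A "mean_shift A f"])
  have "8 * real ?N \<le> 2 ^ l * real (card A)"
  proof -
    have "8 = exp (real 3 * ln 2)"
      by (subst exp_of_nat_mult) simp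
    also have "\<dots> \<le> exp (3 * L)"
      using L by simp
    finally have "8 * exp (24 * L) \<le> exp (3 * L) * exp (24 * L)"
      by (rule mult_right_mono) simp
    also have "\<dots> \<le> exp (ln 2 * l)"
    proof -
      have "1 / 2 * (54 * L) \<le> ln 2 * l"
        using l(1) ln2 \<open>L > 0\<close> by (intro mult_mono) auto
      then show ?thesis
        by (simp flip: exp_add)
    qed
    also have "\<dots> = 2 ^ l"
      by (simp add: exp_of_nat2_mult)
    finally have "8 * exp (24 * L) * card A \<le> 2 ^ l * real (card A)"
      by (rule mult_right_mono) simp
    then show ?thesis
      using density by simp
  qed
  then have l_large: "8 * ?N \<le> 2 ^ l * card A"
    by (simp flip: of_nat_le_iff[where 'a = real])
  have l_small: "l * \<delta> \<le> 1 / 4"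
    using \<open>l \<ge> 1\<close> by (simp add: \<delta>_def)
  have "\<bar>f x\<bar> \<le> 1" for x
    by (simp add: f_def)
  then obtain x where x: "x \<in> carrier G"
    "card (annihilator (set \<Lambda>)) < 2 * (\<Sum>v\<in>annihilator (set \<Lambda>). f (x \<oplus> v))"
    using ex_dense_coset[OF A X \<open>X \<noteq> {}\<close> \<Lambda>(1) _ spec close one l_small l_large] by blast
  have "(\<Sum>v\<in>annihilator (set \<Lambda>). f (x \<oplus> v)) =
      real (card {v \<in> annihilator (set \<Lambda>). x \<oplus> v \<in> S})"
    unfolding f_def by (subst sum_of_bool_eq) (auto intro!: arg_cong[of _ _ card])
  with x(2) have "real (card (annihilator (set \<Lambda>))) <
      real (2 * card {v \<in> annihilator (set \<Lambda>). x \<oplus> v \<in> S})"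
    by (simp only: of_nat_mult of_nat_numeral)
  then have "annihilator (set \<Lambda>) \<subseteq> diff_set G S"
    unfolding of_nat_less_iff by (rule annihilator_subset_difference[OF \<Lambda>(1) x(1)])
  also have "diff_set G S \<subseteq> double_diff_set G A"
  proof
    fix u assume "u \<in> diff_set G S"
    then obtain a1 a2 a3 a4 where a: "a1 \<in> A" "a2 \<in> A" "a3 \<in> A" "a4 \<in> A"
      and u: "u = (a1 \<oplus> a2) \<ominus> (a3 \<oplus> a4)"
      unfolding diff_set_def S_def by blast
    have "u = ((a1 \<oplus> a2) \<ominus> a3) \<ominus> a4"
      using a A(1) unfolding u by (simp add: a_minus_def minus_add a_assoc subset_iff)
    then show "u \<in> double_diff_set G A"
      using a unfolding double_diff_set_def by blast
  qed
  finally show thesis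
    using that \<Lambda>(1) len by blast
qed

end

subsection \<open>Characters of the coordinate space\<close>

text \<open>The standard character \<open>exp (2 * pi * i * t / p)\<close>, taken on integers so
  that products of representatives need no reduction modulo \<open>p\<close>.\<close>

definition add_char :: "nat \<Rightarrow> int \<Rightarrow> complex" where
  "add_char p t = cis (2 * pi * (t / p))"

lemma add_char_add: "add_char p (s + t) = add_char p s * add_char p t"
  by (simp only: add_char_def cis_mult of_int_add add_divide_distrib distrib_left)

lemma add_char_power: "add_char p t ^ u = add_char p (int u * t)"
  by (simp only: add_char_def DeMoivre of_int_mult of_int_of_nat_eq times_divide_eq_right mult_ac)

lemma add_char_eq_1_iff:
  assumes "p > 0"
  shows "add_char p t = 1 \<longleftrightarrow> int p dvd t"
proof
  assume "add_char p t = 1"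
  then have "Re (cis (2 * pi * (t / p))) = Re 1"
    unfolding add_char_def by (rule arg_cong)
  then have "cos (2 * pi * (t / p)) = 1"
    by (simp only: cis.sel one_complex.sel)
  then obtain z :: int where "2 * pi * (t / p) = real_of_int z * 2 * pi"
    unfolding cos_one_2pi_int by blast
  then have "2 * pi * (t / p) = 2 * pi * real_of_int z"
    by (simp only: mult_ac)
  then have "t / p = z"
    by (subst (asm) mult_left_cancel) auto
  then have "real_of_int t = real_of_int (z * int p)"
    using assms by (simp add: divide_eq_eq)
  then show "int p dvd t"
    unfolding of_int_eq_iff by simp
next
  assume "int p dvd t"
  then obtain z where "t = int p * z" ..
  then have "t / p = real_of_int z"
    using assms by simp
  then show "add_char p t = 1"
    by (simp add: add_char_def)
qed

lemma add_char_mod: "add_char p (t mod int p) = add_char p t"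
proof (cases "p = 0")
  case False
  have "add_char p (int p * (t div int p) + t mod int p) = add_char p (t mod int p)"
    using False add_char_eq_1_iff[of p "int p * (t div int p)"] by (simp only: add_char_add) simp
  then show ?thesis
    by simp
qed (simp add: add_char_def)

text \<open>For \<open>x\<close> nonzero in this range \<open>p\<close> does not divide
  \<open>x\<close>, so the terms are all powers of a nontrivial \<open>p\<close>-th root of
  unity.\<close>

lemma sum_add_char:
  assumes "x \<in> {0..<int p}"
  shows "(\<Sum>u\<in>{0..<int p}. add_char p (u * x)) = (if x = 0 then of_nat p else 0)"
proof -
  have "(\<Sum>u\<in>{0..<int p}. add_char p (u * x)) = (\<Sum>u\<in>int ` {..<p}. add_char p (u * x))"
    by (simp add: lessThan_atLeast0 image_int_atLeastLessThan)
  also have "\<dots> = (\<Sum>u<p. add_char p x ^ u)"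
    by (simp add: sum.reindex add_char_power)
  also have "\<dots> = (if x = 0 then of_nat p else 0)"
  proof (cases "x = 0")
    case True
    then show ?thesis
      by (simp add: add_char_def)
  next
    case False
    then have "add_char p x \<noteq> 1"
      using assms add_char_eq_1_iff[of p x] zdvd_imp_le[of "int p" x] by auto
    moreover have "add_char p x ^ p = 1"
      using assms by (simp add: add_char_power add_char_eq_1_iff)
    ultimately show ?thesis
      using False by (simp add: sum_roots_unity_powers)
  qed
  finally show ?thesis .
qed

text \<open>The additive character of the dot product of \<xi> and \<open>x\<close>, as a product so
  that sums over \<xi> factor by coordinates.\<close>

definition dot_char :: "nat \<Rightarrow> nat \<Rightarrow> (nat \<Rightarrow> int) \<Rightarrow> (nat \<Rightarrow> int) \<Rightarrow> complex" where
  "dot_char p n \<xi> x = (\<Prod>i<n. add_char p (\<xi> i * x i))"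

lemma carrier_Fp_space: "carrier (Fp_space p n) = {..<n} \<rightarrow>\<^sub>E {0..<int p}"
proof -
  have "{0..int p - 1} = {0..<int p}"
    by auto
  then show ?thesis
    by (simp add: coord_space_def residue_ring_def)
qed

text \<open>The space indexes its own characters. The sum over all \<xi> is a product of
  one-dimensional sums, nonzero only if every coordinate of \<open>x\<close> is zero.\<close>

lemma complete_characters_Fp_space:
  assumes "prime p"
  shows "complete_characters (Fp_space p n) (carrier (Fp_space p n)) (dot_char p n) p"
proof -
  have p: "p > 0"
    using assms by (rule prime_gt_0_nat)
  have fin: "finite (carrier (Fp_space p n))"
    by (auto simp: carrier_Fp_space intro!: finite_PiE)
  interpret M: Module.module "residue_ring (int p)" "Fp_space p n"
    by (rule module_Fp_space[OF assms])
  show ?thesis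
  proof (intro complete_characters.intro complete_characters_axioms.intro
      finite_additive_group.intro finite_additive_group_axioms.intro M.abelian_group_axioms)
    show "finite (carrier (Fp_space p n))" "finite (carrier (Fp_space p n))" "p > 0"
      using fin p by auto
    fix \<xi> x y
    assume "\<xi> \<in> carrier (Fp_space p n)" "x \<in> carrier (Fp_space p n)" "y \<in> carrier (Fp_space p n)"
    have "add_char p (\<xi> i * ((x i + y i) mod int p)) = add_char p (\<xi> i * x i) * add_char p (\<xi> i * y i)" for i
    proof -
      have "add_char p (\<xi> i * ((x i + y i) mod int p)) = add_char p ((\<xi> i * (x i + y i)) mod int p)"
        by (metis add_char_mod mod_mult_right_eq)
      then show ?thesis
        by (simp add: add_char_mod distrib_left add_char_add)
    qed
    then show "dot_char p n \<xi> (x \<oplus>\<^bsub>Fp_space p n\<^esub> y) = dot_char p n \<xi> x * dot_char p n \<xi> y"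
      by (simp add: dot_char_def coord_space_def residue_ring_def prod.distrib)
  next
    fix \<xi> x
    show "dot_char p n \<xi> x ^ p = 1"
      using p by (auto simp: dot_char_def prod_power_distrib add_char_power add_char_eq_1_iff
          intro!: prod.neutral)
  next
    fix x assume x: "x \<in> carrier (Fp_space p n)"
    have "(\<Sum>\<xi>\<in>carrier (Fp_space p n). dot_char p n \<xi> x) =
        (\<Prod>i<n. \<Sum>u\<in>{0..<int p}. add_char p (u * x i))"
      unfolding carrier_Fp_space dot_char_def
      by (rule prod_sum_PiE[symmetric]) auto
    also have "\<dots> = (\<Prod>i<n. if x i = 0 then of_nat p else 0)"
    proof (rule prod.cong[OF refl])
      fix i assume "i \<in> {..<n}"
      then have "x i \<in> {0..<int p}"
        using x unfolding carrier_Fp_space by (rule PiE_mem[rotated])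
      then show "(\<Sum>u\<in>{0..<int p}. add_char p (u * x i)) = (if x i = 0 then of_nat p else 0)"
        by (rule sum_add_char)
    qed
    also have "\<dots> = (if \<forall>i<n. x i = 0 then of_nat (p ^ n) else 0)"
      by (auto simp: prod_zero_iff)
    also have "(\<forall>i<n. x i = 0) \<longleftrightarrow> x = \<zero>\<^bsub>Fp_space p n\<^esub>"
      using x by (auto simp: carrier_Fp_space coord_space_def residue_ring_def fun_eq_iff PiE_iff extensional_def)
    finally show "(\<Sum>\<xi>\<in>carrier (Fp_space p n). dot_char p n \<xi> x) =
        (if x = \<zero>\<^bsub>Fp_space p n\<^esub> then of_nat (card (carrier (Fp_space p n))) else 0)"
      by (simp only: card_carrier_Fp_space)
  qed
qed

text \<open>Scalars are represented by nonnegative integers \<open>c\<close>, so a character at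
  \<open>c\<close> times \<open>v\<close> is its \<open>c\<close>-th power at \<open>v\<close>,
  again \<open>1\<close>.\<close>

lemma submodule_annihilator_Fp_space:
  assumes "prime p" and \<Lambda>: "\<Lambda> \<subseteq> carrier (Fp_space p n)"
  shows "submodule (complete_characters.annihilator (Fp_space p n) (dot_char p n) \<Lambda>)
    (residue_ring (int p)) (Fp_space p n)"
proof -
  interpret M: Module.module "residue_ring (int p)" "Fp_space p n"
    by (rule module_Fp_space[OF assms(1)])
  interpret complete_characters "Fp_space p n" "carrier (Fp_space p n)" "dot_char p n" p
    by (rule complete_characters_Fp_space[OF assms(1)])
  show ?thesis
  proof (rule M.submoduleI)
    show "annihilator \<Lambda> \<subseteq> carrier (Fp_space p n)"
      by (rule annihilator_subset)
    show "\<zero>\<^bsub>Fp_space p n\<^esub> \<in> annihilator \<Lambda>"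
      by (rule annihilator_zero[OF \<Lambda>])
    show "\<ominus>\<^bsub>Fp_space p n\<^esub> u \<in> annihilator \<Lambda>" if "u \<in> annihilator \<Lambda>" for u
      by (rule annihilator_minus[OF \<Lambda> that])
    show "u \<oplus>\<^bsub>Fp_space p n\<^esub> v \<in> annihilator \<Lambda>" if "u \<in> annihilator \<Lambda>" "v \<in> annihilator \<Lambda>" for u v
      by (rule annihilator_add[OF \<Lambda> that])
    fix c v assume c: "c \<in> carrier (residue_ring (int p))" and v: "v \<in> annihilator \<Lambda>"
    have "c \<ge> 0"
      using c by (simp add: residue_ring_def)
    have "dot_char p n \<xi> (c \<odot>\<^bsub>Fp_space p n\<^esub> v) = dot_char p n \<xi> v ^ nat c" for \<xi>
    proof -
      have "add_char p (\<xi> i * ((c * v i) mod int p)) = add_char p (\<xi> i * v i) ^ nat c" for i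
      proof -
        have "add_char p (\<xi> i * ((c * v i) mod int p)) = add_char p ((\<xi> i * (c * v i)) mod int p)"
          by (metis add_char_mod mod_mult_right_eq)
        then show ?thesis
          using \<open>c \<ge> 0\<close> by (simp add: add_char_mod add_char_power mult_ac)
      qed
      then show ?thesis
        by (simp add: dot_char_def coord_space_def residue_ring_def prod_power_distrib)
    qed
    moreover have "c \<odot>\<^bsub>Fp_space p n\<^esub> v \<in> carrier (Fp_space p n)"
      using c v annihilator_subset by (intro M.smult_closed) auto
    ultimately show "c \<odot>\<^bsub>Fp_space p n\<^esub> v \<in> annihilator \<Lambda>"
      using v by (simp add: annihilator_def)
  qed
qed

section \<open>Density of \<open>A\<close> and dimension count in the coordinate space\<close>

theorem theorem7:
  shows "\<exists>C::real. C > 0 \<and>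
    (\<forall>(p::nat) (n::nat) (K::real) (A::(nat \<Rightarrow> int) set).
      prime p \<longrightarrow> n \<ge> 1 \<longrightarrow> K \<ge> 1 \<longrightarrow>
      A \<subseteq> carrier (Fp_space p n) \<longrightarrow>
      real (card A) \<ge> real p ^ (n - 1) / K ^ 24 \<longrightarrow>
      real (card (diff_set (Fp_space p n) A)) \<le> K * real (card A) \<longrightarrow>
      (\<exists>V. submodule V (residue_ring (int p)) (Fp_space p n) \<and>
           V \<subseteq> double_diff_set (Fp_space p n) A \<and>
           real (card V) \<ge> real p powr (- C * ln (K * real p) ^ 4) * real (card A)))"
proof (rule exI[of _ "200 * (2304 * 14 * 56\<^sup>2)"], intro conjI allI impI)
  let ?C = "200 * (2304 * 14 * 56\<^sup>2) :: real"
  show "?C > 0"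
    by simp
  fix p n :: nat and K :: real and A :: "(nat \<Rightarrow> int) set"
  assume p: "prime p" and n: "n \<ge> 1" and K: "K \<ge> 1" and A: "A \<subseteq> carrier (Fp_space p n)"
    and dense: "real (card A) \<ge> real p ^ (n - 1) / K ^ 24"
  interpret complete_characters "Fp_space p n" "carrier (Fp_space p n)" "dot_char p n" p
    by (rule complete_characters_Fp_space[OF p])
  define L where "L = ln (K * p)"
  have p2: "real p \<ge> 2"
    using prime_ge_2_nat[OF p] by simp
  then have Kp: "K * p \<ge> 2"
    using K mult_mono[of 1 K 2 "real p"] by simp
  then have "ln 2 \<le> L"
    by (simp add: L_def)
  have "0 < real p ^ (n - 1) / K ^ 24"
    using p2 K by simp
  with dense have "card A > 0"
    by linarith
  then have "A \<noteq> {}"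
    by auto
  \<comment> \<open>One factor \<open>p\<close> makes up for the exponent \<open>n - 1\<close>;
    enlarging it to \<open>p ^ 24\<close> merges it with \<open>K ^ 24\<close> into
    \<open>(K * p) ^ 24 = exp (24 * L)\<close>.\<close>
  have "card (carrier (Fp_space p n)) \<le> exp (24 * L) * card A"
  proof -
    have "real p ^ n = p * real p ^ (n - 1)"
      using n by (simp flip: power_Suc)
    also have "\<dots> \<le> p * (K ^ 24 * card A)"
      using dense K by (intro mult_left_mono) (auto simp: field_simps)
    also have "\<dots> \<le> p ^ 24 * (K ^ 24 * card A)"
      using p2 K self_le_power[of "real p" 24] by (intro mult_right_mono) auto
    also have "\<dots> = (K * p) ^ 24 * card A"
      by (simp add: power_mult_distrib mult_ac)
    also have "(K * p) ^ 24 = exp (24 * L)"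
      using Kp exp_of_nat_mult[of 24 L] by (simp add: L_def)
    finally show ?thesis
      by (simp add: card_carrier_Fp_space)
  qed
  then obtain \<Lambda> where \<Lambda>: "set \<Lambda> \<subseteq> carrier (Fp_space p n)" "length \<Lambda> \<le> ?C * L ^ 4"
    "annihilator (set \<Lambda>) \<subseteq> double_diff_set (Fp_space p n) A"
    using bogolyubov_ruzsa[OF A \<open>A \<noteq> {}\<close> \<open>ln 2 \<le> L\<close>] by blast
  let ?V = "annihilator (set \<Lambda>)"
  \<comment> \<open>The annihilator is compared with the whole space, whose size dominates that of
    \<open>A\<close>; the index is at most \<open>p ^ length \<Lambda>\<close>.\<close>
  have "card A \<le> card (carrier (Fp_space p n))"
    using A by (intro card_mono) auto
  also have "\<dots> \<le> p ^ length \<Lambda> * card ?V"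
    by (rule card_annihilator_ge[OF \<Lambda>(1)])
  finally have "real (card A) \<le> real p ^ length \<Lambda> * card ?V"
    by (simp flip: of_nat_le_iff[where 'a = real])
  also have "\<dots> \<le> p powr (?C * L ^ 4) * card ?V"
    using p2 \<Lambda>(2) by (intro mult_right_mono) (auto simp flip: powr_realpow intro!: powr_mono)
  finally have "p powr (- ?C * L ^ 4) * card A \<le> card ?V"
    using p2 by (simp add: powr_minus field_simps)
  then show "\<exists>V. submodule V (residue_ring (int p)) (Fp_space p n) \<and>
           V \<subseteq> double_diff_set (Fp_space p n) A \<and>
           real (card V) \<ge> real p powr (- ?C * ln (K * real p) ^ 4) * real (card A)"
    using \<Lambda> submodule_annihilator_Fp_space[OF p] unfolding L_def by blast
qed

end
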